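(* Let $(\boldsymbol{X},\boldsymbol{T})$ and $(\boldsymbol{Y},\boldsymbol{R})$ be nonautonomous dynamical systems, $Z\subset X_0$ and $W\subset Y_0$. Then for all equicontinuous $\boldsymbol{f}\in\boldsymbol{C}(\boldsymbol{X},\mathbb{R})$ and equicontinuous $\boldsymbol{g}\in\boldsymbol{C}(\boldsymbol{Y},\mathbb{R})$, $$P^{\mathrm{B}}(\boldsymbol{T},\boldsymbol{f},Z)+P^{\mathrm{P}}(\boldsymbol{R},\boldsymbol{g},W)\le P^{\mathrm{P}}(\boldsymbol{T}\times\boldsymbol{R},\boldsymbol{f}\dotplus\boldsymbol{g},Z\times W)\le P^{\mathrm{P}}(\boldsymbol{T},\boldsymbol{f},Z)+P^{\mathrm{P}}(\boldsymbol{R},\boldsymbol{g},W),$$ where it is assumed that the sums of pressures appearing are well defined, i.e. not of the form $\infty-\infty$.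
   Context: A nonautonomous dynamical system (NDS) $(\boldsymbol{X},\boldsymbol{T})$ consists of a sequence $\boldsymbol{X}=\{X_k\}_{k=0}^\infty$ of compact metric spaces $(X_k,d_k)$ and a sequence $\boldsymbol{T}=\{T_k\}_{k=0}^\infty$ of continuous maps $T_k:X_k\to X_{k+1}$. Write $\boldsymbol{T}^0=\mathrm{id}_{X_0}$ and $\boldsymbol{T}^j=T_{j-1}\circ\cdots\circ T_0:X_0\to X_j$. For $n\ge 1$ the $n$-th Bowen metric on $X_0$ is $d_n^{\boldsymbol{T}}(x,y)=\max_{0\le j\le n-1}d_j(\boldsymbol{T}^jx,\boldsymbol{T}^jy)$; $B_n^{\boldsymbol{T}}(x,\varepsilon)$ and $\overline{B}_n^{\boldsymbol{T}}(x,\varepsilon)$ are the open ($<\varepsilon$) and closed ($\le\varepsilon$) balls of this metric. $\boldsymbol{C}(\boldsymbol{X},\mathbb{R})=\prod_{k\ge 0}C(X_k,\mathbb{R})$ is the set of sequences $\boldsymbol{f}=\{f_k\}_{k=0}^\infty$ of continuous functions $f_k:X_k\to\mathbb{R}$, and $S_n^{\boldsymbol{T}}\boldsymbol{f}=\sum_{j=0}^{n-1}f_j\circ\boldsymbol{T}^j$. $\boldsymbol{f}$ is equicontinuous if for every $\varepsilon>0$ there is $\delta>0$ such that for all $k\ge0$ and $x,y\in X_k$ with $d_k(x,y)<\delta$ we have $|f_k(x)-f_k(y)|<\varepsilon$. Products. $\boldsymbol{X}\times\boldsymbol{Y}=\{X_k\times Y_k\}_{k\ge0}$ with metrics $\max\{d_{X_k}(x_1,x_2),d_{Y_k}(y_1,y_2)\}$;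 $\boldsymbol{T}\times\boldsymbol{R}=\{T_k\times R_k\}_{k\ge0}$ with $(T_k\times R_k)(x,y)=(T_kx,R_ky)$; $\boldsymbol{f}\dotplus\boldsymbol{g}=\{f_k\dotplus g_k\}_{k\ge0}$ with $(f_k\dotplus g_k)(x,y)=f_k(x)+g_k(y)$. Bowen pressure. For $s\in\mathbb{R}$, $N>0$, $\varepsilon>0$ let $\mathscr{R}^s_{N,\varepsilon}(\boldsymbol{T},\boldsymbol{f},Z)=\inf\sum_i\exp(-n_is+S_{n_i}^{\boldsymbol{T}}\boldsymbol{f}(x_i))$ over all countable families $\{B_{n_i}^{\boldsymbol{T}}(x_i,\varepsilon)\}_i$ with $n_i\ge N$, $x_i\in X_0$, covering $Z$. Put $\mathscr{R}^s_\varepsilon=\lim_{N\to\infty}\mathscr{R}^s_{N,\varepsilon}$, $P^{\mathrm{B}}(\boldsymbol{T},\boldsymbol{f},Z,\varepsilon)=\inf\{s:\mathscr{R}^s_\varepsilon(\boldsymbol{T},\boldsymbol{f},Z)=0\}=\sup\{s:\mathscr{R}^s_\varepsilon(\boldsymbol{T},\boldsymbol{f},Z)=+\infty\}$, and $P^{\mathrm{B}}(\boldsymbol{T},\boldsymbol{f},Z)=\lim_{\varepsilon\to0}P^{\mathrm{B}}(\boldsymbol{T},\boldsymbol{f},Z,\varepsilon)$. Packing pressure. Let $\mathscr{P}^s_{N,\varepsilon}(\boldsymbol{T},\boldsymbol{f},Z)=\sup\sum_i\exp(-n_is+S_{n_i}^{\boldsymbol{T}}\boldsymbol{f}(x_i))$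 over all (at most) countable pairwise disjoint families $\{\overline{B}_{n_i}^{\boldsymbol{T}}(x_i,\varepsilon)\}_i$ with $x_i\in Z$, $n_i\ge N$. Put $\mathscr{P}^s_{\infty,\varepsilon}=\lim_{N\to\infty}\mathscr{P}^s_{N,\varepsilon}$, $\mathscr{P}^s_\varepsilon(\boldsymbol{T},\boldsymbol{f},Z)=\inf\{\sum_{i=1}^\infty\mathscr{P}^s_{\infty,\varepsilon}(\boldsymbol{T},\boldsymbol{f},Z_i):\bigcup_iZ_i\supset Z\}$, $P^{\mathrm{P}}(\boldsymbol{T},\boldsymbol{f},Z,\varepsilon)=\inf\{s:\mathscr{P}^s_\varepsilon(\boldsymbol{T},\boldsymbol{f},Z)=0\}=\sup\{s:\mathscr{P}^s_\varepsilon(\boldsymbol{T},\boldsymbol{f},Z)=+\infty\}$, and $P^{\mathrm{P}}(\boldsymbol{T},\boldsymbol{f},Z)=\lim_{\varepsilon\to0}P^{\mathrm{P}}(\boldsymbol{T},\boldsymbol{f},Z,\varepsilon)$. All pressures take values in $\mathbb{R}\cup\{\pm\infty\}$. *)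

theory Defs
  imports "HOL-Analysis.Analysis"
begin

section \<open>Nonautonomous dynamical systems\<close>

definition nds :: "(nat \<Rightarrow> 'a metric) \<Rightarrow> (nat \<Rightarrow> 'a \<Rightarrow> 'a) \<Rightarrow> bool" where
  "nds X T \<longleftrightarrow>
     (\<forall>k. compact_space (mtopology_of (X k))) \<and>
     (\<forall>k. continuous_map (mtopology_of (X k)) (mtopology_of (X (Suc k))) (T k))"

primrec orbit_map :: "(nat \<Rightarrow> 'a \<Rightarrow> 'a) \<Rightarrow> nat \<Rightarrow> 'a \<Rightarrow> 'a" where
  "orbit_map T 0 = id"
| "orbit_map T (Suc j) = T j \<circ> orbit_map T j"

text \<open>Only meaningful for \<open>n \<ge> 1\<close>: for \<open>n = 0\<close> this is the unspecified maximum of the empty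
  set. The value at \<open>n = 0\<close> does not affect the pressures, which only depend on large \<open>n\<close>.\<close>

definition bowen_dist ::
  "(nat \<Rightarrow> 'a metric) \<Rightarrow> (nat \<Rightarrow> 'a \<Rightarrow> 'a) \<Rightarrow> nat \<Rightarrow> 'a \<Rightarrow> 'a \<Rightarrow> real" where
  "bowen_dist X T n x y =
     Max ((\<lambda>j. mdist (X j) (orbit_map T j x) (orbit_map T j y)) ` {..<n})"

definition bowen_ball ::
  "(nat \<Rightarrow> 'a metric) \<Rightarrow> (nat \<Rightarrow> 'a \<Rightarrow> 'a) \<Rightarrow> nat \<Rightarrow> 'a \<Rightarrow> real \<Rightarrow> 'a set" where
  "bowen_ball X T n x \<epsilon> = {y \<in> mspace (X 0). bowen_dist X T n x y < \<epsilon>}"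

definition bowen_cball ::
  "(nat \<Rightarrow> 'a metric) \<Rightarrow> (nat \<Rightarrow> 'a \<Rightarrow> 'a) \<Rightarrow> nat \<Rightarrow> 'a \<Rightarrow> real \<Rightarrow> 'a set" where
  "bowen_cball X T n x \<epsilon> = {y \<in> mspace (X 0). bowen_dist X T n x y \<le> \<epsilon>}"

definition potentials :: "(nat \<Rightarrow> 'a metric) \<Rightarrow> (nat \<Rightarrow> 'a \<Rightarrow> real) set" where
  "potentials X = {f. \<forall>k. continuous_map (mtopology_of (X k)) euclideanreal (f k)}"

definition birkhoff_sum ::
  "(nat \<Rightarrow> 'a \<Rightarrow> 'a) \<Rightarrow> (nat \<Rightarrow> 'a \<Rightarrow> real) \<Rightarrow> nat \<Rightarrow> 'a \<Rightarrow> real" where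
  "birkhoff_sum T f n x = (\<Sum>j<n. f j (orbit_map T j x))"

definition equicontinuous :: "(nat \<Rightarrow> 'a metric) \<Rightarrow> (nat \<Rightarrow> 'a \<Rightarrow> real) \<Rightarrow> bool" where
  "equicontinuous X f \<longleftrightarrow>
     (\<forall>\<epsilon>>0. \<exists>\<delta>>0. \<forall>k. \<forall>x\<in>mspace (X k). \<forall>y\<in>mspace (X k).
        mdist (X k) x y < \<delta> \<longrightarrow> \<bar>f k x - f k y\<bar> < \<epsilon>)"

section \<open>Products\<close>

text \<open>The library's \<^const>\<open>prod_metric\<close> carries the Euclidean product distance, so the
  maximum metric is introduced separately.\<close>

definition max_metric :: "'a metric \<Rightarrow> 'b metric \<Rightarrow> ('a \<times> 'b) metric" where
  "max_metric m1 m2 = metric (mspace m1 \<times> mspace m2,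
     \<lambda>(x1, y1) (x2, y2). max (mdist m1 x1 x2) (mdist m2 y1 y2))"

lemma Metric_space_max:
  "Metric_space (mspace m1 \<times> mspace m2)
     (\<lambda>(x1, y1) (x2, y2). max (mdist m1 x1 x2) (mdist m2 y1 y2))"
proof (unfold_locales; clarify)
  fix x1 x2 :: 'a and y1 y2 :: 'b
  show "0 \<le> max (mdist m1 x1 x2) (mdist m2 y1 y2)"
    by (simp add: le_max_iff_disj)
  show "max (mdist m1 x1 x2) (mdist m2 y1 y2) = max (mdist m1 x2 x1) (mdist m2 y2 y1)"
    by (simp add: mdist_commute)
next
  fix x1 x2 :: 'a and y1 y2 :: 'b
  assume "x1 \<in> mspace m1" "y1 \<in> mspace m2" "x2 \<in> mspace m1" "y2 \<in> mspace m2"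
  then have "mdist m1 x1 x2 = 0 \<longleftrightarrow> x1 = x2" "mdist m2 y1 y2 = 0 \<longleftrightarrow> y1 = y2"
    by simp_all
  then show "max (mdist m1 x1 x2) (mdist m2 y1 y2) = 0 \<longleftrightarrow> (x1, y1) = (x2, y2)"
    using mdist_nonneg[of m1 x1 x2] mdist_nonneg[of m2 y1 y2] by (auto simp: max_def split: if_splits dest: order.antisym)
next
  fix x1 x2 x3 :: 'a and y1 y2 y3 :: 'b
  assume "x1 \<in> mspace m1" "y1 \<in> mspace m2" "x2 \<in> mspace m1" "y2 \<in> mspace m2"
    "x3 \<in> mspace m1" "y3 \<in> mspace m2"
  then have "mdist m1 x1 x3 \<le> mdist m1 x1 x2 + mdist m1 x2 x3"
    "mdist m2 y1 y3 \<le> mdist m2 y1 y2 + mdist m2 y2 y3"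
    by (simp_all add: mdist_triangle)
  then show "max (mdist m1 x1 x3) (mdist m2 y1 y3)
      \<le> max (mdist m1 x1 x2) (mdist m2 y1 y2) + max (mdist m1 x2 x3) (mdist m2 y2 y3)"
    by linarith
qed

lemma mspace_max_metric [simp]: "mspace (max_metric m1 m2) = mspace m1 \<times> mspace m2"
  unfolding max_metric_def by (rule Metric_space.mspace_metric[OF Metric_space_max])

lemma mdist_max_metric [simp]:
  "mdist (max_metric m1 m2) (x1, y1) (x2, y2) = max (mdist m1 x1 x2) (mdist m2 y1 y2)"
  unfolding max_metric_def by (simp add: Metric_space.mdist_metric[OF Metric_space_max])

definition prod_spaces ::
  "(nat \<Rightarrow> 'a metric) \<Rightarrow> (nat \<Rightarrow> 'b metric) \<Rightarrow> nat \<Rightarrow> ('a \<times> 'b) metric" where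
  "prod_spaces X Y k = max_metric (X k) (Y k)"

definition prod_maps ::
  "(nat \<Rightarrow> 'a \<Rightarrow> 'a) \<Rightarrow> (nat \<Rightarrow> 'b \<Rightarrow> 'b) \<Rightarrow> nat \<Rightarrow> 'a \<times> 'b \<Rightarrow> 'a \<times> 'b" where
  "prod_maps T R k = map_prod (T k) (R k)"

definition dotplus ::
  "(nat \<Rightarrow> 'a \<Rightarrow> real) \<Rightarrow> (nat \<Rightarrow> 'b \<Rightarrow> real) \<Rightarrow> nat \<Rightarrow> 'a \<times> 'b \<Rightarrow> real" where
  "dotplus f g k = (\<lambda>(x, y). f k x + g k y)"

section \<open>Bowen pressure\<close>

text \<open>An at most countable family of pairs \<open>(x\<^sub>i, n\<^sub>i)\<close> is given by functions \<open>x\<close>, \<open>n\<close> on an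
  index set \<open>I \<subseteq> \<nat>\<close>, which may be finite or empty; the same pair may occur for several indices.\<close>

definition weight ::
  "(nat \<Rightarrow> 'a \<Rightarrow> 'a) \<Rightarrow> (nat \<Rightarrow> 'a \<Rightarrow> real) \<Rightarrow> real \<Rightarrow> nat \<Rightarrow> 'a \<Rightarrow> ennreal" where
  "weight T f s n x = ennreal (exp (- real n * s + birkhoff_sum T f n x))"

definition bowen_pre ::
  "(nat \<Rightarrow> 'a metric) \<Rightarrow> (nat \<Rightarrow> 'a \<Rightarrow> 'a) \<Rightarrow> (nat \<Rightarrow> 'a \<Rightarrow> real) \<Rightarrow> 'a set \<Rightarrow>
     real \<Rightarrow> nat \<Rightarrow> real \<Rightarrow> ennreal" where
  "bowen_pre X T f Z s N \<epsilon> =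
     Inf {(\<Sum>\<^sub>\<infinity>i\<in>I. weight T f s (n i) (x i)) | (I :: nat set) n x.
            (\<forall>i\<in>I. N \<le> n i \<and> x i \<in> mspace (X 0)) \<and>
            Z \<subseteq> (\<Union>i\<in>I. bowen_ball X T (n i) (x i) \<epsilon>)}"

definition bowen_meas ::
  "(nat \<Rightarrow> 'a metric) \<Rightarrow> (nat \<Rightarrow> 'a \<Rightarrow> 'a) \<Rightarrow> (nat \<Rightarrow> 'a \<Rightarrow> real) \<Rightarrow> 'a set \<Rightarrow>
     real \<Rightarrow> real \<Rightarrow> ennreal" where
  "bowen_meas X T f Z s \<epsilon> = lim (\<lambda>N. bowen_pre X T f Z s N \<epsilon>)"

definition bowen_pressure_at ::
  "(nat \<Rightarrow> 'a metric) \<Rightarrow> (nat \<Rightarrow> 'a \<Rightarrow> 'a) \<Rightarrow> (nat \<Rightarrow> 'a \<Rightarrow> real) \<Rightarrow> 'a set \<Rightarrow>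
     real \<Rightarrow> ereal" where
  "bowen_pressure_at X T f Z \<epsilon> = Inf {ereal s | s. bowen_meas X T f Z s \<epsilon> = 0}"

definition bowen_pressure ::
  "(nat \<Rightarrow> 'a metric) \<Rightarrow> (nat \<Rightarrow> 'a \<Rightarrow> 'a) \<Rightarrow> (nat \<Rightarrow> 'a \<Rightarrow> real) \<Rightarrow> 'a set \<Rightarrow> ereal" where
  "bowen_pressure X T f Z = Lim (at_right 0) (\<lambda>\<epsilon>. bowen_pressure_at X T f Z \<epsilon>)"

section \<open>Packing pressure\<close>

definition packing_pre ::
  "(nat \<Rightarrow> 'a metric) \<Rightarrow> (nat \<Rightarrow> 'a \<Rightarrow> 'a) \<Rightarrow> (nat \<Rightarrow> 'a \<Rightarrow> real) \<Rightarrow> 'a set \<Rightarrow>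
     real \<Rightarrow> nat \<Rightarrow> real \<Rightarrow> ennreal" where
  "packing_pre X T f Z s N \<epsilon> =
     Sup {(\<Sum>\<^sub>\<infinity>i\<in>I. weight T f s (n i) (x i)) | (I :: nat set) n x.
            (\<forall>i\<in>I. N \<le> n i \<and> x i \<in> Z) \<and>
            disjoint_family_on (\<lambda>i. bowen_cball X T (n i) (x i) \<epsilon>) I}"

definition packing_lim ::
  "(nat \<Rightarrow> 'a metric) \<Rightarrow> (nat \<Rightarrow> 'a \<Rightarrow> 'a) \<Rightarrow> (nat \<Rightarrow> 'a \<Rightarrow> real) \<Rightarrow> 'a set \<Rightarrow>
     real \<Rightarrow> real \<Rightarrow> ennreal" where
  "packing_lim X T f Z s \<epsilon> = lim (\<lambda>N. packing_pre X T f Z s N \<epsilon>)"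

definition packing_meas ::
  "(nat \<Rightarrow> 'a metric) \<Rightarrow> (nat \<Rightarrow> 'a \<Rightarrow> 'a) \<Rightarrow> (nat \<Rightarrow> 'a \<Rightarrow> real) \<Rightarrow> 'a set \<Rightarrow>
     real \<Rightarrow> real \<Rightarrow> ennreal" where
  "packing_meas X T f Z s \<epsilon> =
     Inf {(\<Sum>i. packing_lim X T f (Zs i) s \<epsilon>) | Zs :: nat \<Rightarrow> 'a set.
            (\<forall>i. Zs i \<subseteq> mspace (X 0)) \<and> Z \<subseteq> (\<Union>i. Zs i)}"

definition packing_pressure_at ::
  "(nat \<Rightarrow> 'a metric) \<Rightarrow> (nat \<Rightarrow> 'a \<Rightarrow> 'a) \<Rightarrow> (nat \<Rightarrow> 'a \<Rightarrow> real) \<Rightarrow> 'a set \<Rightarrow>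
     real \<Rightarrow> ereal" where
  "packing_pressure_at X T f Z \<epsilon> = Inf {ereal s | s. packing_meas X T f Z s \<epsilon> = 0}"

definition packing_pressure ::
  "(nat \<Rightarrow> 'a metric) \<Rightarrow> (nat \<Rightarrow> 'a \<Rightarrow> 'a) \<Rightarrow> (nat \<Rightarrow> 'a \<Rightarrow> real) \<Rightarrow> 'a set \<Rightarrow> ereal" where
  "packing_pressure X T f Z = Lim (at_right 0) (\<lambda>\<epsilon>. packing_pressure_at X T f Z \<epsilon>)"

text \<open>Addition on \<^typ>\<open>ereal\<close> is total, with \<open>\<infinity> + (-\<infinity>) = \<infinity>\<close>, so the well-definedness of a sum
  has to be stated explicitly.\<close>

definition sum_well_defined :: "ereal \<Rightarrow> ereal \<Rightarrow> bool" where
  "sum_well_defined a b \<longleftrightarrow> \<not> (a = \<infinity> \<and> b = -\<infinity>) \<and> \<not> (a = -\<infinity> \<and> b = \<infinity>)"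

end

theory Submission
  imports Defs
begin

text \<open>
  Lower bound. Suppose countably many sets \<open>A\<^sub>i\<close> with finite packing premeasure at some exponent
  below \<open>s + t\<close> cover \<open>Z \<times> W\<close>. If \<open>s\<close> is below the Bowen pressure of \<open>Z\<close>, then for every \<open>w \<in> W\<close>
  some section \<open>A\<^sub>i\<^sup>w\<close> has positive Bowen measure, so \<open>W\<close> is a countable union of sets \<open>V\<close> on which a
  single \<open>A\<^sub>i\<close> has sections of uniformly positive Bowen premeasure. If \<open>t\<close> is below the packing
  pressure of \<open>W\<close>, one such \<open>V\<close> has positive packing premeasure. Put over every centre \<open>y\<close> of a
  packing of \<open>V\<close> a maximal packing of the section \<open>A\<^sub>i\<^sup>y\<close> by balls of the same order; by maximality,
  balls of radius \<open>3\<epsilon>\<close> around its centres cover the section, so its weight is bounded below by the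
  Bowen premeasure. The resulting packing of \<open>A\<^sub>i\<close> has weight bounded below at exponent \<open>s + t\<close>,
  a contradiction.

  Upper bound. At a fixed order \<open>n\<close>, a packing of \<open>A \<times> B\<close> of radius \<open>\<epsilon>\<close> maps injectively into the
  product of maximal packings of \<open>A\<close> and \<open>B\<close> of radius \<open>\<epsilon>/4\<close>, by sending a centre to nearby
  centres; equicontinuity controls the change of the Birkhoff sums by \<open>2n\<eta>\<close>. Summing over \<open>n\<close> costs
  an arbitrarily small increase of the exponent.
\<close>

section \<open>Sums in \<open>ennreal\<close>, monotone one-sided limits and addition in
  \<open>ereal\<close>\<close>

lemma sum_le_infsum_ennreal:
  fixes h :: "'c \<Rightarrow> ennreal"
  assumes "finite F" "F \<subseteq> I"
  shows "sum h F \<le> infsum h I"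
  using assms by (subst nonneg_infsum_complete) (auto intro: SUP_upper)

lemma infsum_ennreal_leI:
  fixes h :: "'c \<Rightarrow> ennreal"
  assumes "\<And>F. finite F \<Longrightarrow> F \<subseteq> I \<Longrightarrow> sum h F \<le> b"
  shows "infsum h I \<le> b"
  using assms by (subst nonneg_infsum_complete) (auto intro: SUP_least)

text \<open>Each value \<open>F e\<close> bounds the values at smaller radii from below, so they
  rise to their supremum. This turns the limit in the definition of both pressures into a supremum
  over the radius.\<close>

lemma Lim_at_right_antimono_on:
  fixes F :: "real \<Rightarrow> ereal"
  assumes "antimono_on {0<..} F"
  shows "Lim (at_right 0) F = (SUP e\<in>{0<..}. F e)"
proof (rule tendsto_Lim, simp, rule order_tendstoI)
  fix a assume "a < (SUP e\<in>{0<..}. F e)"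
  then obtain e where e: "0 < e" "a < F e"
    by (auto simp: less_SUP_iff)
  have "eventually (\<lambda>d. d \<in> {0<..<e}) (at_right 0)"
    using e by (intro eventually_at_right_real) auto
  then show "\<forall>\<^sub>F d in at_right 0. a < F d"
  proof eventually_elim
    case (elim d)
    then have "F e \<le> F d"
      using e by (intro monotone_onD[OF assms]) auto
    with e show ?case by simp
  qed
next
  fix a assume *: "(SUP e\<in>{0<..}. F e) < a"
  have "eventually (\<lambda>d. d > 0) (at_right (0::real))"
    by (rule eventually_at_right_less)
  then show "\<forall>\<^sub>F d in at_right 0. F d < a"
  proof eventually_elim
    case (elim d)
    then have "F d \<le> (SUP e\<in>{0<..}. F e)"
      by (intro SUP_upper) simp
    with * show ?case by simp
  qed
qed

text \<open>Reduces an inequality between pressures to real exponents strictly below them. If one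
  summand is \<infinity>, the exponent below it can be arbitrarily large while the other stays
  fixed. No real lies below -\<infinity>, where \<open>le\<close> would be vacuous.\<close>

lemma ereal_add_le_if_less:
  fixes a b c :: ereal
  assumes "a \<noteq> -\<infinity>" "b \<noteq> -\<infinity>"
    and le: "\<And>s t. ereal s < a \<Longrightarrow> ereal t < b \<Longrightarrow> ereal s + ereal t \<le> c"
  shows "a + b \<le> c"
proof -
  obtain s t where st: "ereal s < a" "ereal t < b"
    using assms(1,2) ereal_dense2[of "-\<infinity>" a] ereal_dense2[of "-\<infinity>" b] by auto
  show ?thesis
  proof (cases "a = \<infinity> \<or> b = \<infinity>")
    case True
    have "ereal B \<le> c" for B
    proof (cases "a = \<infinity>")
      case True
      with le[of "B - t" t] st show ?thesis by simp
    next
      case False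
      with \<open>a = \<infinity> \<or> b = \<infinity>\<close> le[of s "B - s"] st show ?thesis by simp
    qed
    then have "c = \<infinity>" by (rule ereal_top)
    then show ?thesis by simp
  next
    case False
    then obtain x y where xy: "a = ereal x" "b = ereal y"
      using assms(1,2) by (cases a; cases b) auto
    show ?thesis
    proof (rule ereal_le_epsilon2)
      fix d :: real assume "0 < d"
      with le[of "x - d / 2" "y - d / 2"] xy show "a + b \<le> c + ereal d"
        by (cases c) auto
    qed
  qed
qed

text \<open>Negating all three values leads back to \<open>ereal_add_le_if_less\<close>, so that
  \<infinity> becomes the excluded value.\<close>

lemma ereal_le_add_if_greater:
  fixes a b c :: ereal
  assumes "a \<noteq> \<infinity>" "b \<noteq> \<infinity>"
    and le: "\<And>s t. a < ereal s \<Longrightarrow> b < ereal t \<Longrightarrow> c \<le> ereal s + ereal t"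
  shows "c \<le> a + b"
proof -
  have "- a + - b \<le> - c"
  proof (rule ereal_add_le_if_less)
    fix s t assume "ereal s < - a" "ereal t < - b"
    then have "a < ereal (- s)" "b < ereal (- t)"
      using ereal_less_uminus_reorder[of "ereal s" a] ereal_less_uminus_reorder[of "ereal t" b] by simp_all
    from le[OF this] show "ereal s + ereal t \<le> - c"
      by (cases c) auto
  qed (use assms(1,2) in \<open>simp_all add: ereal_uminus_eq_reorder\<close>)
  then show ?thesis
    using assms(1,2) by (cases a; cases b; cases c) auto
qed

section \<open>Bowen balls\<close>

text \<open>\<open>0 < n\<close> keeps the maximum from ranging over the empty set, where its value
  is unspecified.\<close>

lemma bowen_dist_le_iff:
  assumes "0 < n"
  shows "bowen_dist X T n x y \<le> r \<longleftrightarrow> (\<forall>j<n. mdist (X j) (orbit_map T j x) (orbit_map T j y) \<le> r)"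
  using assms unfolding bowen_dist_def by (subst Max_le_iff) auto

lemma bowen_dist_less_iff:
  assumes "0 < n"
  shows "bowen_dist X T n x y < r \<longleftrightarrow> (\<forall>j<n. mdist (X j) (orbit_map T j x) (orbit_map T j y) < r)"
  using assms unfolding bowen_dist_def by (subst Max_less_iff) auto

lemma orbit_map_continuous:
  assumes "nds X T"
  shows "continuous_map (mtopology_of (X 0)) (mtopology_of (X j)) (orbit_map T j)"
proof (induction j)
  case (Suc j)
  moreover have "continuous_map (mtopology_of (X j)) (mtopology_of (X (Suc j))) (T j)"
    using assms by (simp add: nds_def)
  ultimately show ?case
    by (simp only: orbit_map.simps continuous_map_compose)
qed simp

lemma orbit_map_in_mspace:
  assumes "nds X T" "x \<in> mspace (X 0)"
  shows "orbit_map T j x \<in> mspace (X j)"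
  using continuous_map_funspace[OF orbit_map_continuous[OF assms(1)]] assms(2)
  by (auto simp: Pi_iff)

lemma bowen_dist_commute: "bowen_dist X T n x y = bowen_dist X T n y x"
  by (simp add: bowen_dist_def mdist_commute)

lemma bowen_dist_self:
  assumes "nds X T" "x \<in> mspace (X 0)" "0 < n"
  shows "bowen_dist X T n x x \<le> 0"
  using mdist_zero[OF orbit_map_in_mspace[OF assms(1,2)] orbit_map_in_mspace[OF assms(1,2)]]
  by (simp add: bowen_dist_le_iff[OF \<open>0 < n\<close>])

lemma bowen_dist_triangle_le:
  assumes "nds X T" "x \<in> mspace (X 0)" "y \<in> mspace (X 0)" "z \<in> mspace (X 0)" "0 < n"
    and "bowen_dist X T n x y \<le> r" "bowen_dist X T n y z \<le> s"
  shows "bowen_dist X T n x z \<le> r + s"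
  unfolding bowen_dist_le_iff[OF \<open>0 < n\<close>]
proof (intro allI impI)
  fix j assume "j < n"
  then have "mdist (X j) (orbit_map T j x) (orbit_map T j y) \<le> r"
    "mdist (X j) (orbit_map T j y) (orbit_map T j z) \<le> s"
    using assms(6,7) by (auto simp: bowen_dist_le_iff[OF \<open>0 < n\<close>])
  then show "mdist (X j) (orbit_map T j x) (orbit_map T j z) \<le> r + s"
    using mdist_triangle[of "orbit_map T j x" "X j" "orbit_map T j y" "orbit_map T j z"]
      orbit_map_in_mspace[OF assms(1)] assms(2-4) by fastforce
qed

text \<open>A Bowen ball is a finite intersection of preimages of open balls under the continuous
  maps \<open>orbit_map T j\<close>.\<close>

lemma openin_bowen_ball:
  assumes "nds X T" "x \<in> mspace (X 0)" "0 < n"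
  shows "openin (mtopology_of (X 0)) (bowen_ball X T n x r)"
proof -
  have "bowen_ball X T n x r =
    (\<Inter>j\<in>{..<n}. {y \<in> mspace (X 0). orbit_map T j y \<in> mball_of (X j) (orbit_map T j x) r})"
    using assms orbit_map_in_mspace[OF assms(1)]
    by (auto simp: bowen_ball_def bowen_dist_less_iff)
  also have "openin (mtopology_of (X 0)) \<dots>"
  proof (intro openin_INT2)
    fix j
    have "openin (mtopology_of (X j)) (mball_of (X j) (orbit_map T j x) r)"
      unfolding mball_of_def mtopology_of_def
      by (rule Metric_space.openin_mball) simp
    then show "openin (mtopology_of (X 0))
        {y \<in> mspace (X 0). orbit_map T j y \<in> mball_of (X j) (orbit_map T j x) r}"
      using openin_continuous_map_preimage[OF orbit_map_continuous[OF assms(1)]] by fastforce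
  qed (use assms in auto)
  finally show ?thesis .
qed

text \<open>Compactness enters here: the open balls of order \<open>n\<close> around all points of
  \<open>X 0\<close> have a finite subcover.\<close>

lemma finite_bowen_cover:
  assumes "nds X T" "0 < n" "0 < r"
  obtains C where "finite C" "C \<subseteq> mspace (X 0)" "mspace (X 0) \<subseteq> (\<Union>c\<in>C. bowen_ball X T n c r)"
proof -
  have "compactin (mtopology_of (X 0)) (mspace (X 0))"
    using assms unfolding nds_def compact_space_def by (metis topspace_mtopology_of)
  moreover have "x \<in> bowen_ball X T n x r" if "x \<in> mspace (X 0)" for x
    using bowen_dist_self[OF assms(1) that assms(2)] that assms(3) by (simp add: bowen_ball_def)
  then have "mspace (X 0) \<subseteq> \<Union>((\<lambda>c. bowen_ball X T n c r) ` mspace (X 0))"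
    by blast
  moreover have "\<forall>U\<in>(\<lambda>c. bowen_ball X T n c r) ` mspace (X 0). openin (mtopology_of (X 0)) U"
    using openin_bowen_ball[OF assms(1) _ assms(2)] by blast
  ultimately obtain \<F> where "finite \<F>" "\<F> \<subseteq> (\<lambda>c. bowen_ball X T n c r) ` mspace (X 0)"
    "mspace (X 0) \<subseteq> \<Union>\<F>"
    unfolding compactin_def by meson
  moreover then obtain C where "C \<subseteq> mspace (X 0)" "finite C" "\<F> = (\<lambda>c. bowen_ball X T n c r) ` C"
    by (meson finite_subset_image)
  ultimately show thesis
    using that by blast
qed

text \<open>Otherwise the centre \<open>y\<close> would lie in both balls.\<close>

lemma disjoint_cballs_imp_far:
  assumes "nds X T" "0 < n" "0 \<le> r" "y \<in> mspace (X 0)"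
    and "bowen_cball X T n x r \<inter> bowen_cball X T n y r = {}"
  shows "r < bowen_dist X T n x y"
proof (rule ccontr)
  assume "\<not> r < bowen_dist X T n x y"
  then have "y \<in> bowen_cball X T n x r" "y \<in> bowen_cball X T n y r"
    using bowen_dist_self[OF assms(1,4,2)] assms(3,4) by (auto simp: bowen_cball_def)
  with assms(5) show False by blast
qed

text \<open>Every packing injects into one finite cover, so cardinalities are bounded and a packing
  of greatest cardinality exists. The ball around any further point of \<open>A\<close> meets one of
  its balls, and the triangle inequality gives \<open>2 * r\<close>.\<close>

lemma finite_maximal_packing:
  assumes "nds X T" "0 < n" "0 < r" "A \<subseteq> mspace (X 0)"
  obtains E where "finite E" "E \<subseteq> A" "disjoint_family_on (\<lambda>x. bowen_cball X T n x r) E"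
    and "\<And>a. a \<in> A \<Longrightarrow> \<exists>e\<in>E. bowen_dist X T n e a \<le> 2 * r"
proof -
  \<comment> \<open>Two centres in one ball of radius \<open>r / 2\<close> are at distance at most
    \<open>r\<close>, while disjoint closed balls of radius \<open>r\<close> have centres farther
    apart than \<open>r\<close>.\<close>
  obtain C where C: "finite C" "C \<subseteq> mspace (X 0)"
      "mspace (X 0) \<subseteq> (\<Union>c\<in>C. bowen_ball X T n c (r / 2))"
    using finite_bowen_cover[OF assms(1,2), of "r / 2"] assms(3) by auto
  let ?P = "\<lambda>E. finite E \<and> E \<subseteq> A \<and> disjoint_family_on (\<lambda>x. bowen_cball X T n x r) E"
  have bound: "card E \<le> card C" if E: "?P E" for E
  proof -
    have "\<forall>x\<in>E. \<exists>c\<in>C. bowen_dist X T n c x < r / 2"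
      using E assms(4) C(3) by (force simp: bowen_ball_def)
    then obtain h where h: "\<And>x. x \<in> E \<Longrightarrow> h x \<in> C \<and> bowen_dist X T n (h x) x < r / 2"
      by metis
    have "inj_on h E"
    proof (rule inj_onI, rule ccontr)
      fix x y assume xy: "x \<in> E" "y \<in> E" "h x = h y" "x \<noteq> y"
      have m: "x \<in> mspace (X 0)" "y \<in> mspace (X 0)" "h x \<in> mspace (X 0)"
        using xy h E assms(4) C(2) by auto
      have "bowen_dist X T n x y \<le> r / 2 + r / 2"
        using bowen_dist_triangle_le[OF assms(1) m(1,3,2) assms(2), of "r/2" "r/2"]
          h[OF xy(1)] h[OF xy(2)] xy(3) by (simp add: bowen_dist_commute)
      moreover have "r < bowen_dist X T n x y"
        using disjoint_cballs_imp_far[OF assms(1,2) _ m(2)] assms(3) E xy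
        by (auto simp: disjoint_family_on_def)
      ultimately show False by simp
    qed
    then show ?thesis
      using h C(1) by (intro card_inj_on_le[of h]) auto
  qed
  have "?P {}"
    by (simp add: disjoint_family_on_def)
  then obtain E where E: "?P E" and max: "\<And>E'. ?P E' \<Longrightarrow> card E' \<le> card E"
    using ex_has_greatest_nat[of ?P "{}" card "card C + 1"] bound by (metis less_Suc_eq_le Suc_eq_plus1)
  have "\<exists>e\<in>E. bowen_dist X T n e a \<le> 2 * r" if a: "a \<in> A" for a
  proof (cases "a \<in> E")
    case True
    with bowen_dist_self[OF assms(1) _ assms(2), of a] a assms(3,4) show ?thesis
      by (intro bexI[of _ a]) auto
  next
    case False
    then have "\<not> ?P (insert a E)"
      using max[of "insert a E"] E by auto
    then obtain e where e: "e \<in> E" "bowen_cball X T n a r \<inter> bowen_cball X T n e r \<noteq> {}"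
      using E a False by (auto simp: disjoint_family_on_insert)
    then obtain z where z: "z \<in> mspace (X 0)" "bowen_dist X T n e z \<le> r" "bowen_dist X T n a z \<le> r"
      by (auto simp: bowen_cball_def)
    have "bowen_dist X T n e a \<le> r + r"
      using bowen_dist_triangle_le[OF assms(1) _ z(1) _ assms(2) z(2), of a r] z(3) e(1) E a assms(4)
      by (auto simp: bowen_dist_commute)
    then show ?thesis using e(1) by auto
  qed
  with E show thesis using that by blast
qed

text \<open>The premeasures admit only families indexed by sets of naturals; the bijection transfers
  to them families indexed by points or pairs.\<close>

lemma countable_index_nat:
  assumes "countable J"
  obtains I :: "nat set" and h where "bij_betw h I J"
  using bij_betw_from_nat_into_finite[of J] bij_betw_from_nat_into[OF assms] by blast

section \<open>Bowen and packing pressures\<close>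

lemma bowen_pre_le_infsum:
  assumes "countable J" "\<And>i. i \<in> J \<Longrightarrow> N \<le> n i \<and> x i \<in> mspace (X 0)"
    and "Z \<subseteq> (\<Union>i\<in>J. bowen_ball X T (n i) (x i) r)"
  shows "bowen_pre X T f Z s N r \<le> (\<Sum>\<^sub>\<infinity>i\<in>J. weight T f s (n i) (x i))"
proof -
  obtain I :: "nat set" and h where h: "bij_betw h I J"
    using countable_index_nat[OF assms(1)] .
  have "(\<Sum>\<^sub>\<infinity>i\<in>J. weight T f s (n i) (x i)) = (\<Sum>\<^sub>\<infinity>i\<in>I. weight T f s ((n \<circ> h) i) ((x \<circ> h) i))"
    using infsum_reindex_bij_betw[OF h, of "\<lambda>i. weight T f s (n i) (x i)"] by simp
  moreover have "Z \<subseteq> (\<Union>i\<in>I. bowen_ball X T ((n \<circ> h) i) ((x \<circ> h) i) r)"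
    using assms(3) bij_betw_imp_surj_on[OF h] by auto
  moreover have "\<forall>i\<in>I. N \<le> (n \<circ> h) i \<and> (x \<circ> h) i \<in> mspace (X 0)"
    using assms(2) bij_betwE[OF h] by auto
  ultimately show ?thesis
    unfolding bowen_pre_def by (intro Inf_lower) blast
qed

lemma bowen_pre_lessE:
  assumes "bowen_pre X T f Z s N r < b"
  obtains I :: "nat set" and n x where "\<And>i. i \<in> I \<Longrightarrow> N \<le> n i \<and> x i \<in> mspace (X 0)"
    "Z \<subseteq> (\<Union>i\<in>I. bowen_ball X T (n i) (x i) r)"
    "(\<Sum>\<^sub>\<infinity>i\<in>I. weight T f s (n i) (x i)) < b"
  using assms unfolding bowen_pre_def Inf_less_iff by blast

lemma bowen_pre_mono_N:
  assumes "M \<le> N"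
  shows "bowen_pre X T f Z s M r \<le> bowen_pre X T f Z s N r"
  unfolding bowen_pre_def using assms by (intro Inf_superset_mono) force

lemma bowen_pre_mono_set:
  assumes "Z \<subseteq> Z'"
  shows "bowen_pre X T f Z s N r \<le> bowen_pre X T f Z' s N r"
  unfolding bowen_pre_def using assms by (intro Inf_superset_mono) blast

lemma bowen_meas_eq_SUP: "bowen_meas X T f Z s r = (SUP N. bowen_pre X T f Z s N r)"
  unfolding bowen_meas_def
  by (intro limI LIMSEQ_SUP) (simp add: incseq_def bowen_pre_mono_N)

text \<open>Covers of the \<open>A i\<close> with total weights below a convergent series of small
  terms are joined into one cover of the union. The order bound \<open>N\<close> stays fixed
  throughout.\<close>

lemma bowen_pre_UN_eq_0:
  fixes A :: "nat \<Rightarrow> 'a set"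
  assumes "\<And>i. bowen_pre X T f (A i) s N r = 0"
  shows "bowen_pre X T f (\<Union>i. A i) s N r = 0"
proof -
  have "bowen_pre X T f (\<Union>i. A i) s N r \<le> ennreal \<eta>" if "0 < \<eta>" for \<eta>
  proof -
    \<comment> \<open>These bounds sum to \<eta> over all \<open>i\<close>.\<close>
    define c where "c i = ennreal (\<eta> * (1 / 2) ^ Suc i)" for i
    have "\<exists>(I :: nat set) n x. (\<forall>k\<in>I. N \<le> n k \<and> x k \<in> mspace (X 0)) \<and>
        A i \<subseteq> (\<Union>k\<in>I. bowen_ball X T (n k) (x k) r) \<and>
        (\<Sum>\<^sub>\<infinity>k\<in>I. weight T f s (n k) (x k)) < c i" for i
    proof -
      have "bowen_pre X T f (A i) s N r < c i"
        using assms[of i] that by (simp add: c_def)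
      then obtain I :: "nat set" and n x where "\<And>k. k \<in> I \<Longrightarrow> N \<le> n k \<and> x k \<in> mspace (X 0)"
        "A i \<subseteq> (\<Union>k\<in>I. bowen_ball X T (n k) (x k) r)"
        "(\<Sum>\<^sub>\<infinity>k\<in>I. weight T f s (n k) (x k)) < c i"
        by (rule bowen_pre_lessE) (rule that)
      then show ?thesis
        by (intro exI[of _ I] exI[of _ n] exI[of _ x]) simp
    qed
    then have "\<exists>(I :: nat \<Rightarrow> nat set) n x. \<forall>i. (\<forall>k\<in>I i. N \<le> n i k \<and> x i k \<in> mspace (X 0)) \<and>
        A i \<subseteq> (\<Union>k\<in>I i. bowen_ball X T (n i k) (x i k) r) \<and>
        (\<Sum>\<^sub>\<infinity>k\<in>I i. weight T f s (n i k) (x i k)) < c i"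
      by (subst choice_iff[symmetric])+ blast
    then obtain I :: "nat \<Rightarrow> nat set" and n x
      where fam: "\<And>i k. k \<in> I i \<Longrightarrow> N \<le> n i k \<and> x i k \<in> mspace (X 0)"
        and cover: "\<And>i. A i \<subseteq> (\<Union>k\<in>I i. bowen_ball X T (n i k) (x i k) r)"
        and small: "\<And>i. (\<Sum>\<^sub>\<infinity>k\<in>I i. weight T f s (n i k) (x i k)) < c i"
      by blast
    let ?J = "SIGMA i:UNIV. I i"
    have "bowen_pre X T f (\<Union>i. A i) s N r \<le>
        (\<Sum>\<^sub>\<infinity>p\<in>?J. weight T f s (case_prod n p) (case_prod x p))"
    proof (rule bowen_pre_le_infsum)
      show "(\<Union>i. A i) \<subseteq> (\<Union>p\<in>?J. bowen_ball X T (case_prod n p) (case_prod x p) r)"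
        using cover by fastforce
    qed (use fam in auto)
    also have "\<dots> \<le> ennreal \<eta>"
    proof (rule infsum_ennreal_leI)
      fix F assume F: "finite F" "F \<subseteq> ?J"
      let ?G = "\<lambda>i. {k. (i, k) \<in> F}"
      have fin: "finite (?G i)" for i
        using finite_vimageI[OF F(1), of "Pair i"] by (simp add: inj_on_def vimage_def)
      \<comment> \<open>A finite part of the joined family is sliced by its first index; each slice
        is a finite part of the cover of one \<open>A i\<close>.\<close>
      have "F = (SIGMA i:fst ` F. ?G i)"
        by force
      then have "(\<Sum>p\<in>F. weight T f s (case_prod n p) (case_prod x p)) =
          (\<Sum>i\<in>fst ` F. \<Sum>k\<in>?G i. weight T f s (n i k) (x i k))"
        using F(1) fin by (subst sum.Sigma) (auto intro!: sum.cong)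
      also have "\<dots> \<le> (\<Sum>i\<in>fst ` F. c i)"
      proof (rule sum_mono)
        fix i
        have "(\<Sum>k\<in>?G i. weight T f s (n i k) (x i k)) \<le> (\<Sum>\<^sub>\<infinity>k\<in>I i. weight T f s (n i k) (x i k))"
          using F fin by (intro sum_le_infsum_ennreal) auto
        then show "(\<Sum>k\<in>?G i. weight T f s (n i k) (x i k)) \<le> c i"
          using small[of i] by simp
      qed
      also have "\<dots> = ennreal (\<Sum>i\<in>fst ` F. \<eta> * (1 / 2) ^ Suc i)"
        unfolding c_def using that by (intro sum_ennreal) auto
      also have "(\<Sum>i\<in>fst ` F. \<eta> * (1 / 2) ^ Suc i) \<le> (\<Sum>i. \<eta> * (1 / 2) ^ Suc i)"
        using that F(1) by (intro sum_le_suminf summable_mult) (auto intro: sums_summable[OF power_half_series])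
      also have "(\<Sum>i. \<eta> * (1 / 2) ^ Suc i) = \<eta>"
        using sums_unique[OF sums_mult[OF power_half_series, of \<eta>]] by simp
      finally show "(\<Sum>p\<in>F. weight T f s (case_prod n p) (case_prod x p)) \<le> ennreal \<eta>"
        by (simp add: ennreal_leI)
    qed
    finally show ?thesis .
  qed
  then show ?thesis
    using ennreal_le_epsilon[of 0 "bowen_pre X T f (\<Union>i. A i) s N r"] by simp
qed

section \<open>Packings and the packing premeasure\<close>

text \<open>Finite packings suffice: a sum of nonnegative terms is the supremum of its finite
  partial sums, and a subfamily of a packing is a packing.\<close>

lemma packing_pre_leI:
  assumes "\<And>(J :: nat set) n x. finite J \<Longrightarrow> (\<And>i. i \<in> J \<Longrightarrow> N \<le> n i \<and> x i \<in> Z) \<Longrightarrow>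
      disjoint_family_on (\<lambda>i. bowen_cball X T (n i) (x i) r) J \<Longrightarrow>
      (\<Sum>i\<in>J. weight T f s (n i) (x i)) \<le> b"
  shows "packing_pre X T f Z s N r \<le> b"
  unfolding packing_pre_def
proof (rule Sup_least, clarify)
  fix I :: "nat set" and n x
  assume "\<forall>i\<in>I. N \<le> n i \<and> x i \<in> Z" "disjoint_family_on (\<lambda>i. bowen_cball X T (n i) (x i) r) I"
  then show "(\<Sum>\<^sub>\<infinity>i\<in>I. weight T f s (n i) (x i)) \<le> b"
    by (intro infsum_ennreal_leI assms) (auto intro: disjoint_family_on_mono)
qed

lemma less_packing_preE:
  assumes "b < packing_pre X T f Z s N r"
  obtains J :: "nat set" and n x where "finite J" "\<And>i. i \<in> J \<Longrightarrow> N \<le> n i \<and> x i \<in> Z"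
    "disjoint_family_on (\<lambda>i. bowen_cball X T (n i) (x i) r) J"
    "b < (\<Sum>i\<in>J. weight T f s (n i) (x i))"
proof (rule ccontr)
  assume contra: "\<not> thesis"
  have "packing_pre X T f Z s N r \<le> b"
    by (rule packing_pre_leI, rule ccontr) (use contra that in \<open>auto simp: not_le\<close>)
  with assms show False by simp
qed

text \<open>Since \<open>J\<close> may have any type, a packing can be indexed by its centres or by
  pairs.\<close>

lemma sum_le_packing_pre:
  assumes "finite J" "\<And>i. i \<in> J \<Longrightarrow> N \<le> n i \<and> x i \<in> Z"
    and "disjoint_family_on (\<lambda>i. bowen_cball X T (n i) (x i) r) J"
  shows "(\<Sum>i\<in>J. weight T f s (n i) (x i)) \<le> packing_pre X T f Z s N r"
proof -
  obtain I :: "nat set" and h where h: "bij_betw h I J"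
    using countable_index_nat[OF countable_finite[OF assms(1)]] .
  have "(\<Sum>i\<in>J. weight T f s (n i) (x i)) = (\<Sum>\<^sub>\<infinity>i\<in>I. weight T f s ((n \<circ> h) i) ((x \<circ> h) i))"
    using infsum_reindex_bij_betw[OF h, of "\<lambda>i. weight T f s (n i) (x i)"] assms(1) by simp
  moreover have "\<forall>i\<in>I. N \<le> (n \<circ> h) i \<and> (x \<circ> h) i \<in> Z"
    using assms(2) bij_betwE[OF h] by auto
  moreover have "disjoint_family_on (\<lambda>i. bowen_cball X T ((n \<circ> h) i) ((x \<circ> h) i) r) I"
    using assms(3) bij_betwE[OF h] bij_betw_imp_inj_on[OF h]
    by (auto simp: disjoint_family_on_def inj_on_eq_iff)
  ultimately show ?thesis
    unfolding packing_pre_def by (intro Sup_upper) blast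
qed

lemma packing_pre_antimono_N:
  assumes "M \<le> N"
  shows "packing_pre X T f Z s N r \<le> packing_pre X T f Z s M r"
  unfolding packing_pre_def using assms by (intro Sup_subset_mono) force

lemma packing_lim_eq_INF: "packing_lim X T f Z s r = (INF N. packing_pre X T f Z s N r)"
  unfolding packing_lim_def
  by (intro limI LIMSEQ_INF) (simp add: decseq_def packing_pre_antimono_N)

text \<open>Naturals outside the index set are filled with the empty set, which admits only the
  empty packing and so has limit 0.\<close>

lemma packing_meas_eq_0I:
  assumes "countable J" "\<And>j. j \<in> J \<Longrightarrow> A j \<subseteq> mspace (X 0)" "Z \<subseteq> (\<Union>j\<in>J. A j)"
    and "\<And>j. j \<in> J \<Longrightarrow> packing_lim X T f (A j) s r = 0"
  shows "packing_meas X T f Z s r = 0"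
proof -
  have empty: "packing_lim X T f {} s r = 0"
  proof -
    have "packing_pre X T f {} s 0 r \<le> 0"
      by (rule packing_pre_leI) (auto intro!: sum.neutral)
    then show ?thesis
      unfolding packing_lim_eq_INF by (metis INF_lower UNIV_I le_zero_eq order_trans)
  qed
  obtain I :: "nat set" and h where h: "bij_betw h I J"
    using countable_index_nat[OF assms(1)] .
  define B where "B i = (if i \<in> I then A (h i) else {})" for i
  have "packing_lim X T f (B i) s r = 0" for i
    using assms(4) bij_betwE[OF h] empty by (simp add: B_def)
  then have "(\<Sum>i. packing_lim X T f (B i) s r) = 0"
    by simp
  moreover have "Z \<subseteq> (\<Union>i. B i)"
    using assms(3) bij_betw_imp_surj_on[OF h] unfolding B_def by fastforce
  moreover have "\<forall>i. B i \<subseteq> mspace (X 0)"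
    using assms(2) bij_betwE[OF h] by (auto simp: B_def)
  ultimately have "packing_meas X T f Z s r \<le> 0"
    unfolding packing_meas_def by (intro Inf_lower) force
  then show ?thesis by simp
qed

text \<open>A cover of total value below 1 has only finite terms. By
  \<open>packing_lim_eq_0_if_less\<close> they vanish at every larger exponent.\<close>

lemma packing_meas_eq_0E:
  assumes "packing_meas X T f Z s r = 0"
  obtains A :: "nat \<Rightarrow> 'a set" where "\<And>i. A i \<subseteq> mspace (X 0)" "Z \<subseteq> (\<Union>i. A i)"
    "\<And>i. packing_lim X T f (A i) s r < \<infinity>"
proof -
  have "packing_meas X T f Z s r < 1"
    using assms by simp
  then obtain A :: "nat \<Rightarrow> 'a set" where A: "\<And>i. A i \<subseteq> mspace (X 0)" "Z \<subseteq> (\<Union>i. A i)"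
    "(\<Sum>i. packing_lim X T f (A i) s r) < 1"
    unfolding packing_meas_def Inf_less_iff by blast
  have "packing_lim X T f (A i) s r < \<infinity>" for i
    using ennreal_suminf_lessD[OF A(3), of i] by (simp add: less_trans[OF _ ennreal_one_less_top])
  with A show thesis using that by blast
qed

lemma packing_lim_less_top_pre:
  assumes "packing_lim X T f Z s r < \<infinity>"
  obtains N where "packing_pre X T f Z s N r < \<infinity>"
  using assms unfolding packing_lim_eq_INF INF_less_iff by blast

section \<open>Dependence on the radius, and the pressures as suprema\<close>

text \<open>A cover by balls of radius \<open>d\<close> remains one after enlarging them to radius
  \<open>e\<close>, so the larger radius gives the smaller infimum.\<close>

lemma bowen_pressure_at_antimono: "antimono_on {0<..} (bowen_pressure_at X T f Z)"
proof (rule monotone_onI)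
  fix d e :: real assume "d \<le> e"
  have "bowen_pre X T f Z s N e \<le> bowen_pre X T f Z s N d" for s N
    unfolding bowen_pre_def
  proof (rule Inf_superset_mono, clarify)
    fix I :: "nat set" and n x
    assume *: "\<forall>i\<in>I. N \<le> n i \<and> x i \<in> mspace (X 0)" "Z \<subseteq> (\<Union>i\<in>I. bowen_ball X T (n i) (x i) d)"
    have "bowen_ball X T (n i) (x i) d \<subseteq> bowen_ball X T (n i) (x i) e" for i
      using \<open>d \<le> e\<close> by (auto simp: bowen_ball_def)
    with * have "Z \<subseteq> (\<Union>i\<in>I. bowen_ball X T (n i) (x i) e)" by blast
    with * show "\<exists>(J :: nat set) m y. (\<Sum>\<^sub>\<infinity>i\<in>I. weight T f s (n i) (x i)) = (\<Sum>\<^sub>\<infinity>i\<in>J. weight T f s (m i) (y i)) \<and>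
      (\<forall>i\<in>J. N \<le> m i \<and> y i \<in> mspace (X 0)) \<and> Z \<subseteq> (\<Union>i\<in>J. bowen_ball X T (m i) (y i) e)"
      by blast
  qed
  then have "bowen_meas X T f Z s e \<le> bowen_meas X T f Z s d" for s
    unfolding bowen_meas_eq_SUP by (intro SUP_mono) auto
  then have "bowen_meas X T f Z s e = 0" if "bowen_meas X T f Z s d = 0" for s
    using that by (metis le_zero_eq)
  then show "bowen_pressure_at X T f Z e \<le> bowen_pressure_at X T f Z d"
    unfolding bowen_pressure_at_def by (intro Inf_superset_mono) blast
qed

text \<open>Disjoint closed balls stay disjoint when shrunk, so the smaller radius gives the larger
  supremum.\<close>

lemma packing_pressure_at_antimono: "antimono_on {0<..} (packing_pressure_at X T f Z)"
proof (rule monotone_onI)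
  fix d e :: real assume "d \<le> e"
  have "packing_pre X T f A s N e \<le> packing_pre X T f A s N d" for A s N
    unfolding packing_pre_def
  proof (rule Sup_subset_mono, clarify)
    fix I :: "nat set" and n x
    assume *: "\<forall>i\<in>I. N \<le> n i \<and> x i \<in> A" "disjoint_family_on (\<lambda>i. bowen_cball X T (n i) (x i) e) I"
    have "bowen_cball X T (n i) (x i) d \<subseteq> bowen_cball X T (n i) (x i) e" for i
      using \<open>d \<le> e\<close> by (auto simp: bowen_cball_def)
    with *(2) have "disjoint_family_on (\<lambda>i. bowen_cball X T (n i) (x i) d) I"
      unfolding disjoint_family_on_def by blast
    with * show "\<exists>(J :: nat set) m y. (\<Sum>\<^sub>\<infinity>i\<in>I. weight T f s (n i) (x i)) = (\<Sum>\<^sub>\<infinity>i\<in>J. weight T f s (m i) (y i)) \<and>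
      (\<forall>i\<in>J. N \<le> m i \<and> y i \<in> A) \<and> disjoint_family_on (\<lambda>i. bowen_cball X T (m i) (y i) d) J"
      by blast
  qed
  then have lim: "packing_lim X T f A s e \<le> packing_lim X T f A s d" for A s
    unfolding packing_lim_eq_INF by (intro INF_mono) auto
  have "packing_meas X T f Z s e \<le> packing_meas X T f Z s d" for s
    unfolding packing_meas_def
  proof (rule Inf_mono, clarify)
    fix A :: "nat \<Rightarrow> 'a set" assume "\<forall>i. A i \<subseteq> mspace (X 0)" "Z \<subseteq> (\<Union>i. A i)"
    moreover have "(\<Sum>i. packing_lim X T f (A i) s e) \<le> (\<Sum>i. packing_lim X T f (A i) s d)"
      by (intro suminf_le lim) auto
    ultimately show "\<exists>a\<in>{\<Sum>i. packing_lim X T f (Zs i) s e |Zs. (\<forall>i. Zs i \<subseteq> mspace (X 0)) \<and> Z \<subseteq> \<Union> (range Zs)}.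
        a \<le> (\<Sum>i. packing_lim X T f (A i) s d)"
      by blast
  qed
  then have "packing_meas X T f Z s e = 0" if "packing_meas X T f Z s d = 0" for s
    using that by (metis le_zero_eq)
  then show "packing_pressure_at X T f Z e \<le> packing_pressure_at X T f Z d"
    unfolding packing_pressure_at_def by (intro Inf_superset_mono) blast
qed

lemma bowen_pressure_eq_SUP: "bowen_pressure X T f Z = (SUP e\<in>{0<..}. bowen_pressure_at X T f Z e)"
  unfolding bowen_pressure_def by (rule Lim_at_right_antimono_on[OF bowen_pressure_at_antimono])

lemma packing_pressure_eq_SUP: "packing_pressure X T f Z = (SUP e\<in>{0<..}. packing_pressure_at X T f Z e)"
  unfolding packing_pressure_def by (rule Lim_at_right_antimono_on[OF packing_pressure_at_antimono])

section \<open>Products\<close>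

lemma orbit_map_prod_maps: "orbit_map (prod_maps T R) j = map_prod (orbit_map T j) (orbit_map R j)"
  unfolding fun_eq_iff by (induction j) (simp_all add: prod_maps_def)

text \<open>The maximum metric makes product balls products of balls. Two of them are therefore
  disjoint as soon as their factors in one coordinate are.\<close>

lemma bowen_cball_prod:
  assumes "0 < n"
  shows "bowen_cball (prod_spaces X Y) (prod_maps T R) n (x, y) r =
    bowen_cball X T n x r \<times> bowen_cball Y R n y r"
  using assms
  by (auto simp: bowen_cball_def bowen_dist_le_iff orbit_map_prod_maps prod_spaces_def)

lemma weight_prod:
  "weight (prod_maps T R) (dotplus f g) (s + t) n (x, y) = weight T f s n x * weight R g t n y"
  by (simp add: weight_def birkhoff_sum_def orbit_map_prod_maps dotplus_def sum.distrib
      ennreal_mult'[symmetric] exp_add[symmetric] algebra_simps)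

lemma weight_add_exponent: "weight T f (s + d) n x = ennreal (exp (- real n * d)) * weight T f s n x"
  by (simp add: weight_def ennreal_mult'[symmetric] exp_add[symmetric] algebra_simps)

text \<open>Raising the exponent by \<open>d\<close> multiplies a weight of order at least
  \<open>N\<close> by at most \<open>exp (- real N * d)\<close>, which tends to 0 while the
  premeasure at \<open>u\<close> stays bounded.\<close>

lemma packing_lim_eq_0_if_less:
  assumes "packing_lim X T f Z u r < \<infinity>" "u < s"
  shows "packing_lim X T f Z s r = 0"
proof -
  define d where "d = s - u"
  have d: "0 < d" "s = u + d"
    using assms(2) by (auto simp: d_def)
  obtain M where M: "packing_pre X T f Z u M r < \<infinity>"
    using packing_lim_less_top_pre[OF assms(1)] .
  then obtain c where c: "packing_pre X T f Z u M r = ennreal c" "0 \<le> c"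
    by (cases "packing_pre X T f Z u M r") auto
  have bound: "packing_lim X T f Z s r \<le> ennreal (exp (- real N * d) * c)" if "M \<le> N" for N
  proof -
    have "packing_lim X T f Z s r \<le> packing_pre X T f Z s N r"
      unfolding packing_lim_eq_INF by (rule INF_lower) simp
    also have "\<dots> \<le> ennreal (exp (- real N * d)) * packing_pre X T f Z u M r"
    proof (rule packing_pre_leI)
      fix J :: "nat set" and n x
      assume J: "finite J" "\<And>i. i \<in> J \<Longrightarrow> N \<le> n i \<and> x i \<in> Z"
        "disjoint_family_on (\<lambda>i. bowen_cball X T (n i) (x i) r) J"
      have "(\<Sum>i\<in>J. weight T f s (n i) (x i)) \<le>
          (\<Sum>i\<in>J. ennreal (exp (- real N * d)) * weight T f u (n i) (x i))"
        unfolding d(2) weight_add_exponent using J(2) d(1)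
        by (intro sum_mono mult_right_mono ennreal_leI) auto
      also have "\<dots> = ennreal (exp (- real N * d)) * (\<Sum>i\<in>J. weight T f u (n i) (x i))"
        by (simp add: sum_distrib_left)
      also have "\<dots> \<le> ennreal (exp (- real N * d)) * packing_pre X T f Z u M r"
        using J that by (intro mult_left_mono sum_le_packing_pre) force+
      finally show "(\<Sum>i\<in>J. weight T f s (n i) (x i)) \<le> \<dots>" .
    qed
    finally show ?thesis
      using c by (simp add: ennreal_mult')
  qed
  have "(\<lambda>N. exp (- d) ^ N * c) \<longlonglongrightarrow> 0 * c"
    using d(1) by (intro tendsto_mult tendsto_const LIMSEQ_power_zero) simp
  then have "(\<lambda>N. ennreal (exp (- real N * d) * c)) \<longlonglongrightarrow> ennreal 0"
    by (intro tendsto_ennrealI) (simp add: exp_of_nat_mult[symmetric])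
  then have "packing_lim X T f Z s r \<le> ennreal 0"
    by (rule LIMSEQ_le_const) (use bound in blast)
  then show ?thesis by simp
qed

section \<open>Lower bound\<close>

text \<open>A Fubini-type bound. As \<open>b\<close> and \<open>M\<close> are the same for all
  \<open>w\<close>, packings of arbitrarily high order have weight at least \<open>c * b\<close>,
  and this survives in the limit.\<close>

lemma packing_lim_prod_neq_0:
  assumes "nds X T" "0 < e" "A \<subseteq> mspace (X 0) \<times> mspace (Y 0)" "0 < b"
    and large: "\<And>w. w \<in> W \<Longrightarrow> b \<le> bowen_pre X T f {x. (x, w) \<in> A} s M (3 * e)"
    and "packing_lim Y R g W t e \<noteq> 0"
  shows "packing_lim (prod_spaces X Y) (prod_maps T R) (dotplus f g) A (s + t) e \<noteq> 0"
proof -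
  \<comment> \<open>The limit is an infimum over \<open>N\<close>, so every premeasure of
    \<open>W\<close> exceeds \<open>c\<close>.\<close>
  obtain c where c: "0 < c" "c < packing_lim Y R g W t e"
    using assms(6) dense zero_less_iff_neq_zero by metis
  let ?pre = "\<lambda>N. packing_pre (prod_spaces X Y) (prod_maps T R) (dotplus f g) A (s + t) N e"
  have *: "c * b \<le> ?pre N" if N: "M \<le> N" "0 < N" for N
  proof -
    have "c < packing_pre Y R g W t N e"
      using c(2) unfolding packing_lim_eq_INF by (rule less_INF_D) simp
    then obtain J :: "nat set" and n y where J: "finite J" "\<And>j. j \<in> J \<Longrightarrow> N \<le> n j \<and> y j \<in> W"
      "disjoint_family_on (\<lambda>j. bowen_cball Y R (n j) (y j) e) J"
      "c < (\<Sum>j\<in>J. weight R g t (n j) (y j))"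
      by (rule less_packing_preE) (rule that)
    have "\<exists>E. finite E \<and> E \<subseteq> {x. (x, y j) \<in> A} \<and>
        disjoint_family_on (\<lambda>x. bowen_cball X T (n j) x e) E \<and>
        (\<forall>a\<in>{x. (x, y j) \<in> A}. \<exists>x\<in>E. bowen_dist X T (n j) x a \<le> 2 * e)" if "j \<in> J" for j
    proof -
      have "0 < n j" using J(2)[OF that] N by simp
      moreover have "{x. (x, y j) \<in> A} \<subseteq> mspace (X 0)" using assms(3) by blast
      ultimately obtain E where "finite E" "E \<subseteq> {x. (x, y j) \<in> A}"
        "disjoint_family_on (\<lambda>x. bowen_cball X T (n j) x e) E"
        "\<And>a. a \<in> {x. (x, y j) \<in> A} \<Longrightarrow> \<exists>x\<in>E. bowen_dist X T (n j) x a \<le> 2 * e"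
        using finite_maximal_packing[OF assms(1) _ assms(2)] by metis
      then show ?thesis
        by (intro exI[of _ E]) blast
    qed
    then have "\<forall>j\<in>J. \<exists>E. finite E \<and> E \<subseteq> {x. (x, y j) \<in> A} \<and>
        disjoint_family_on (\<lambda>x. bowen_cball X T (n j) x e) E \<and>
        (\<forall>a\<in>{x. (x, y j) \<in> A}. \<exists>x\<in>E. bowen_dist X T (n j) x a \<le> 2 * e)"
      by (rule ballI)
    from bchoice[OF this] obtain E where fam: "\<forall>j\<in>J. finite (E j) \<and> E j \<subseteq> {x. (x, y j) \<in> A} \<and>
        disjoint_family_on (\<lambda>x. bowen_cball X T (n j) x e) (E j) \<and>
        (\<forall>a\<in>{x. (x, y j) \<in> A}. \<exists>x\<in>E j. bowen_dist X T (n j) x a \<le> 2 * e)"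
      by (rule exE)
    have E: "finite (E j)" "E j \<subseteq> {x. (x, y j) \<in> A}"
        "disjoint_family_on (\<lambda>x. bowen_cball X T (n j) x e) (E j)"
        "\<And>a. (a, y j) \<in> A \<Longrightarrow> \<exists>x\<in>E j. bowen_dist X T (n j) x a \<le> 2 * e" if "j \<in> J" for j
      using bspec[OF fam that] by simp_all
    have inner: "b \<le> (\<Sum>x\<in>E j. weight T f s (n j) x)" if j: "j \<in> J" for j
    proof -
      have "bowen_pre X T f {x. (x, y j) \<in> A} s M (3 * e) \<le> (\<Sum>\<^sub>\<infinity>x\<in>E j. weight T f s (n j) x)"
      proof (rule bowen_pre_le_infsum)
        show "countable (E j)" using E(1)[OF j] by (rule countable_finite)
        show "M \<le> n j \<and> x \<in> mspace (X 0)" if "x \<in> E j" for x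
          using J(2)[OF j] N E(2)[OF j] that assms(3) by auto
        \<comment> \<open>Maximality gives distance at most \<open>2 * e\<close>; radius
          \<open>3 * e\<close> makes the inequality strict, as open balls require.\<close>
        show "{x. (x, y j) \<in> A} \<subseteq> (\<Union>x\<in>E j. bowen_ball X T (n j) x (3 * e))"
        proof clarify
          fix a assume a: "(a, y j) \<in> A"
          then obtain x where "x \<in> E j" "bowen_dist X T (n j) x a \<le> 2 * e"
            using E(4)[OF j] by blast
          then show "a \<in> (\<Union>x\<in>E j. bowen_ball X T (n j) x (3 * e))"
            using a assms(2,3) unfolding bowen_ball_def by force
        qed
      qed
      with large[of "y j"] J(2)[OF j] E(1)[OF j] show ?thesis by simp
    qed
    have "c * b \<le> (\<Sum>j\<in>J. weight R g t (n j) (y j)) * b"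
      using J(4) by (intro mult_right_mono) auto
    also have "\<dots> \<le> (\<Sum>j\<in>J. weight R g t (n j) (y j) * (\<Sum>x\<in>E j. weight T f s (n j) x))"
      unfolding sum_distrib_right using inner by (intro sum_mono mult_left_mono) auto
    also have "\<dots> = (\<Sum>j\<in>J. \<Sum>x\<in>E j. weight (prod_maps T R) (dotplus f g) (s + t) (n j) (x, y j))"
      by (simp add: weight_prod sum_distrib_left mult.commute)
    also have "\<dots> = (\<Sum>p\<in>Sigma J E. weight (prod_maps T R) (dotplus f g) (s + t) (n (fst p)) (snd p, y (fst p)))"
      using J(1) E(1) by (subst sum.Sigma) (auto simp: split_def)
    also have "\<dots> \<le> ?pre N"
    proof (rule sum_le_packing_pre)
      show "finite (Sigma J E)" using J(1) E(1) by (rule finite_SigmaI)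
      show "N \<le> n (fst p) \<and> (snd p, y (fst p)) \<in> A" if "p \<in> Sigma J E" for p
        using that J(2)[of "fst p"] E(2)[of "fst p"] by auto
      show "disjoint_family_on (\<lambda>p. bowen_cball (prod_spaces X Y) (prod_maps T R) (n (fst p))
          (snd p, y (fst p)) e) (Sigma J E)"
        unfolding disjoint_family_on_def
      proof (intro ballI impI)
        fix p q assume pq: "p \<in> Sigma J E" "q \<in> Sigma J E" "p \<noteq> q"
        obtain j x k z where p: "p = (j, x)" "q = (k, z)" by fastforce
        have pos: "0 < n j" "0 < n k"
          using pq p J(2) N(2) by fastforce+
        show "bowen_cball (prod_spaces X Y) (prod_maps T R) (n (fst p)) (snd p, y (fst p)) e \<inter>
          bowen_cball (prod_spaces X Y) (prod_maps T R) (n (fst q)) (snd q, y (fst q)) e = {}"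
        \<comment> \<open>Balls over the same \<open>y j\<close> are separated in the first factor,
          balls over different indices in the second.\<close>
        proof (cases "j = k")
          case True
          then have "bowen_cball X T (n j) x e \<inter> bowen_cball X T (n k) z e = {}"
            using pq p disjoint_family_onD[OF E(3), of j x z] by auto
          then show ?thesis
            using pos by (simp add: p bowen_cball_prod Times_Int_Times)
        next
          case False
          then have "bowen_cball Y R (n j) (y j) e \<inter> bowen_cball Y R (n k) (y k) e = {}"
            using pq p disjoint_family_onD[OF J(3), of j k] by auto
          then show ?thesis
            using pos by (simp add: p bowen_cball_prod Times_Int_Times)
        qed
      qed
    qed
    finally show ?thesis .
  qed
  have "c * b \<le> ?pre N" for N
  proof -
    \<comment> \<open>The bound holds for positive orders from \<open>M\<close> on; antitonicity
      carries it to every \<open>N\<close>.\<close>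
    have "c * b \<le> ?pre (max N (max M 1))"
      by (rule *) auto
    also have "\<dots> \<le> ?pre N"
      by (rule packing_pre_antimono_N) simp
    finally show ?thesis .
  qed
  then have "c * b \<le> packing_lim (prod_spaces X Y) (prod_maps T R) (dotplus f g) A (s + t) e"
    unfolding packing_lim_eq_INF by (intro INF_greatest)
  moreover have "0 < c * b"
    using c(1) assms(4) by (simp add: ennreal_zero_less_mult_iff)
  ultimately show ?thesis by auto
qed

text \<open>A failing inequality gives an exponent \<open>u < s + t\<close> at which the packing
  measure of the product vanishes. The strict gap makes every piece of the resulting cover null at
  \<open>s + t\<close>, which contradicts \<open>packing_lim_prod_neq_0\<close> on some
  \<open>V i m\<close>.\<close>

lemma packing_pressure_at_prod_ge:
  fixes X :: "nat \<Rightarrow> 'a metric" and Y :: "nat \<Rightarrow> 'b metric"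
  assumes "nds X T" "0 < e" "W \<subseteq> mspace (Y 0)"
    and s: "ereal s < bowen_pressure_at X T f Z (3 * e)"
    and t: "ereal t < packing_pressure_at Y R g W e"
  shows "ereal (s + t) \<le>
    packing_pressure_at (prod_spaces X Y) (prod_maps T R) (dotplus f g) (Z \<times> W) e"
proof (rule ccontr)
  let ?P = "prod_spaces X Y" and ?Q = "prod_maps T R" and ?h = "dotplus f g"
  assume "\<not> ?thesis"
  then obtain u where u: "u < s + t" "packing_meas ?P ?Q ?h (Z \<times> W) u e = 0"
    unfolding packing_pressure_at_def by (auto simp: not_le Inf_less_iff)
  obtain A :: "nat \<Rightarrow> ('a \<times> 'b) set" where A: "\<And>i. A i \<subseteq> mspace (?P 0)" "Z \<times> W \<subseteq> (\<Union>i. A i)"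
      "\<And>i. packing_lim ?P ?Q ?h (A i) u e < \<infinity>"
    by (rule packing_meas_eq_0E[OF u(2)]) (rule that)
  have A0: "packing_lim ?P ?Q ?h (A i) (s + t) e = 0" for i
    by (rule packing_lim_eq_0_if_less[OF A(3) u(1)])
  \<comment> \<open>The index \<open>m\<close> is both the order bound and, through its inverse, the
    level. One index suffices because the premeasure grows with the order bound and the level
    falls.\<close>
  define V where "V i m = {w \<in> W. ennreal (inverse (real (Suc m))) \<le> bowen_pre X T f {x. (x, w) \<in> A i} s m (3 * e)}"
    for i m
  have "packing_lim Y R g (V i m) t e = 0" for i m
  proof (rule ccontr)
    assume "packing_lim Y R g (V i m) t e \<noteq> 0"
    then have "packing_lim ?P ?Q ?h (A i) (s + t) e \<noteq> 0"
    proof (rule packing_lim_prod_neq_0[where M = m, OF assms(1,2), rotated 3])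
      show "A i \<subseteq> mspace (X 0) \<times> mspace (Y 0)"
        using A(1)[of i] by (simp add: prod_spaces_def)
      show "0 < ennreal (inverse (real (Suc m)))"
        by simp
    qed (simp add: V_def)
    with A0 show False by simp
  qed
  moreover have "W \<subseteq> (\<Union>(i, m)\<in>UNIV. V i m)"
  proof
    fix w assume w: "w \<in> W"
    \<comment> \<open>The sections over \<open>w\<close> together cover \<open>Z\<close>. If all
      were null at every \<open>N\<close>, the Bowen measure of \<open>Z\<close> at \<open>s\<close>
      would be 0.\<close>
    have "\<exists>i N. bowen_pre X T f {x. (x, w) \<in> A i} s N (3 * e) \<noteq> 0"
    proof (rule ccontr)
      assume "\<not> ?thesis"
      then have "bowen_pre X T f (\<Union>i. {x. (x, w) \<in> A i}) s N (3 * e) = 0" for N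
        by (intro bowen_pre_UN_eq_0) simp
      moreover have "Z \<subseteq> (\<Union>i. {x. (x, w) \<in> A i})"
        using A(2) w by blast
      ultimately have "bowen_pre X T f Z s N (3 * e) = 0" for N
        using bowen_pre_mono_set[of Z "\<Union>i. {x. (x, w) \<in> A i}" X T f s N "3 * e"] by simp
      then have "bowen_meas X T f Z s (3 * e) = 0"
        by (simp add: bowen_meas_eq_SUP)
      then have "bowen_pressure_at X T f Z (3 * e) \<le> ereal s"
        unfolding bowen_pressure_at_def by (intro Inf_lower) blast
      with s show False by simp
    qed
    then obtain i N where pos: "bowen_pre X T f {x. (x, w) \<in> A i} s N (3 * e) \<noteq> 0"
      by blast
    obtain k where k: "ennreal (inverse (real (Suc k))) < bowen_pre X T f {x. (x, w) \<in> A i} s N (3 * e)"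
    proof (cases "bowen_pre X T f {x. (x, w) \<in> A i} s N (3 * e)")
      case (real q)
      with pos have "0 < q" by (cases "q = 0") auto
      then obtain k where "inverse (real (Suc k)) < q"
        using reals_Archimedean by blast
      with real \<open>0 < q\<close> show thesis
        by (intro that[of k]) (simp add: ennreal_lessI)
    next
      case top
      then show thesis by (intro that[of 0]) simp
    qed
    define m where "m = max k N"
    have "ennreal (inverse (real (Suc m))) \<le> ennreal (inverse (real (Suc k)))"
      by (intro ennreal_leI le_imp_inverse_le) (auto simp: m_def)
    also have "\<dots> \<le> bowen_pre X T f {x. (x, w) \<in> A i} s N (3 * e)"
      using k by simp
    also have "\<dots> \<le> bowen_pre X T f {x. (x, w) \<in> A i} s m (3 * e)"
      by (rule bowen_pre_mono_N) (simp add: m_def)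
    finally show "w \<in> (\<Union>(i, m)\<in>UNIV. V i m)"
      using w by (auto simp: V_def)
  qed
  moreover have "V i m \<subseteq> mspace (Y 0)" for i m
    using assms(3) by (auto simp: V_def)
  ultimately have "packing_meas Y R g W t e = 0"
    by (intro packing_meas_eq_0I[of UNIV "\<lambda>(i, m). V i m"]) (simp_all add: split_def)
  then have "packing_pressure_at Y R g W e \<le> ereal t"
    unfolding packing_pressure_at_def by (intro Inf_lower) blast
  with t show False by simp
qed

lemma bowen_pressure_add_packing_pressure_le:
  assumes "nds X T" "W \<subseteq> mspace (Y 0)"
    and wd: "sum_well_defined (bowen_pressure X T f Z) (packing_pressure Y R g W)"
  shows "bowen_pressure X T f Z + packing_pressure Y R g W
    \<le> packing_pressure (prod_spaces X Y) (prod_maps T R) (dotplus f g) (Z \<times> W)"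
    (is "?a + ?b \<le> ?c")
proof -
  have *: "ereal s + ereal t \<le> ?c" if st: "ereal s < ?a" "ereal t < ?b" for s t
  proof -
    obtain d where d: "0 < d" "ereal s < bowen_pressure_at X T f Z d"
      using st(1) unfolding bowen_pressure_eq_SUP less_SUP_iff by auto
    obtain d' where d': "0 < d'" "ereal t < packing_pressure_at Y R g W d'"
      using st(2) unfolding packing_pressure_eq_SUP less_SUP_iff by auto
    \<comment> \<open>Both pressures grow as the radius shrinks, so the strict inequalities persist
      at \<open>3 * e\<close> and \<open>e\<close>.\<close>
    define e where "e = min (d / 3) d'"
    have e: "0 < e" "3 * e \<le> d" "e \<le> d'"
      using d(1) d'(1) by (auto simp: e_def min_def)
    have "ereal s < bowen_pressure_at X T f Z (3 * e)"
      using d monotone_onD[OF bowen_pressure_at_antimono, of "3 * e" d X T f Z] e by (simp add: less_le_trans)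
    moreover have "ereal t < packing_pressure_at Y R g W e"
      using d' monotone_onD[OF packing_pressure_at_antimono, of e d' Y R g W] e by (simp add: less_le_trans)
    ultimately have "ereal (s + t) \<le> packing_pressure_at (prod_spaces X Y) (prod_maps T R) (dotplus f g) (Z \<times> W) e"
      by (rule packing_pressure_at_prod_ge[where Y = Y, OF assms(1) e(1) assms(2)])
    also have "\<dots> \<le> ?c"
      unfolding packing_pressure_eq_SUP using e(1) by (intro SUP_upper) simp
    finally show ?thesis by simp
  qed
  show ?thesis
  \<comment> \<open>In \<open>ereal\<close> the sum of \<infinity> and -\<infinity> is \<infinity>;
    \<open>wd\<close> rules this out, so one summand -\<infinity> makes the whole sum
    -\<infinity>.\<close>
  proof (cases "?a = -\<infinity> \<or> ?b = -\<infinity>")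
    case True
    with wd have "?a + ?b = -\<infinity>"
      unfolding sum_well_defined_def by (cases ?a; cases ?b) auto
    then show ?thesis by (simp only: ereal_less_eq)
  next
    case False
    then show ?thesis
      by (intro ereal_add_le_if_less[OF _ _ *]) simp_all
  qed
qed

section \<open>Upper bound\<close>

lemma birkhoff_sum_le:
  assumes "nds X T" "x \<in> mspace (X 0)" "y \<in> mspace (X 0)" "0 < n" "bowen_dist X T n x y \<le> r"
    and "\<And>k x y. x \<in> mspace (X k) \<Longrightarrow> y \<in> mspace (X k) \<Longrightarrow> mdist (X k) x y \<le> r \<Longrightarrow> \<bar>f k x - f k y\<bar> \<le> \<eta>"
  shows "birkhoff_sum T f n y \<le> birkhoff_sum T f n x + real n * \<eta>"
proof -
  have "f j (orbit_map T j y) \<le> f j (orbit_map T j x) + \<eta>" if "j < n" for j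
    using assms(6)[of "orbit_map T j x" j "orbit_map T j y"] orbit_map_in_mspace[OF assms(1)] assms(2-5) that
    by (fastforce simp: bowen_dist_le_iff)
  then have "birkhoff_sum T f n y \<le> (\<Sum>j<n. f j (orbit_map T j x) + \<eta>)"
    unfolding birkhoff_sum_def by (intro sum_mono) auto
  then show ?thesis
    by (simp add: birkhoff_sum_def sum.distrib)
qed

text \<open>The extra \<eta> in the exponent cancels the error \<open>real n * \<eta>\<close> of the
  Birkhoff sum.\<close>

lemma weight_le:
  assumes "nds X T" "x \<in> mspace (X 0)" "y \<in> mspace (X 0)" "0 < n" "bowen_dist X T n x y \<le> r"
    and "\<And>k x y. x \<in> mspace (X k) \<Longrightarrow> y \<in> mspace (X k) \<Longrightarrow> mdist (X k) x y \<le> r \<Longrightarrow> \<bar>f k x - f k y\<bar> \<le> \<eta>"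
  shows "weight T f (s + \<eta>) n y \<le> weight T f s n x"
  using birkhoff_sum_le[OF assms] unfolding weight_def
  by (intro ennreal_leI) (simp add: algebra_simps)

text \<open>All balls have the same order \<open>n\<close>, so closeness of two centres in both
  factors contradicts disjointness. The \<eta> added to each exponent absorbs the change of the
  Birkhoff sums.\<close>

lemma sum_weight_prod_le:
  assumes nds: "nds X T" "nds Y R" and pos: "0 < e" "0 < n" and "N \<le> n"
    and sub: "A \<subseteq> mspace (X 0)" "B \<subseteq> mspace (Y 0)"
    and f: "\<And>k x y. x \<in> mspace (X k) \<Longrightarrow> y \<in> mspace (X k) \<Longrightarrow> mdist (X k) x y \<le> e / 2 \<Longrightarrow> \<bar>f k x - f k y\<bar> \<le> \<eta>"
    and g: "\<And>k x y. x \<in> mspace (Y k) \<Longrightarrow> y \<in> mspace (Y k) \<Longrightarrow> mdist (Y k) x y \<le> e / 2 \<Longrightarrow> \<bar>g k x - g k y\<bar> \<le> \<eta>"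
    and J: "finite J" "\<And>i. i \<in> J \<Longrightarrow> p i \<in> A \<times> B"
      "disjoint_family_on (\<lambda>i. bowen_cball (prod_spaces X Y) (prod_maps T R) n (p i) e) J"
  shows "(\<Sum>i\<in>J. weight (prod_maps T R) (dotplus f g) ((u + \<eta>) + (v + \<eta>)) n (p i))
    \<le> packing_pre X T f A u N (e / 4) * packing_pre Y R g B v N (e / 4)"
proof -
  \<comment> \<open>Radius \<open>e / 4\<close> puts every point within \<open>e / 2\<close> of a
    chosen centre, so two points sharing that centre are within \<open>e\<close> of each
    other.\<close>
  obtain E where E: "finite E" "E \<subseteq> A" "disjoint_family_on (\<lambda>x. bowen_cball X T n x (e / 4)) E"
      "\<And>a. a \<in> A \<Longrightarrow> \<exists>x\<in>E. bowen_dist X T n x a \<le> 2 * (e / 4)"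
    using finite_maximal_packing[OF nds(1) pos(2) _ sub(1), of "e / 4"] pos(1) by auto
  obtain F where F: "finite F" "F \<subseteq> B" "disjoint_family_on (\<lambda>y. bowen_cball Y R n y (e / 4)) F"
      "\<And>b. b \<in> B \<Longrightarrow> \<exists>y\<in>F. bowen_dist Y R n y b \<le> 2 * (e / 4)"
    using finite_maximal_packing[OF nds(2) pos(2) _ sub(2), of "e / 4"] pos(1) by auto
  obtain \<alpha> where \<alpha>: "\<And>a. a \<in> A \<Longrightarrow> \<alpha> a \<in> E" "\<And>a. a \<in> A \<Longrightarrow> bowen_dist X T n (\<alpha> a) a \<le> e / 2"
    using E(4) by simp metis
  obtain \<beta> where \<beta>: "\<And>b. b \<in> B \<Longrightarrow> \<beta> b \<in> F" "\<And>b. b \<in> B \<Longrightarrow> bowen_dist Y R n (\<beta> b) b \<le> e / 2"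
    using F(4) by simp metis
  define h where "h i = (\<alpha> (fst (p i)), \<beta> (snd (p i)))" for i
  have p: "fst (p i) \<in> A" "snd (p i) \<in> B" if "i \<in> J" for i
    using J(2)[OF that] by auto
  have near: "p k \<in> bowen_cball (prod_spaces X Y) (prod_maps T R) n (p i) e"
    if "i \<in> J" "k \<in> J" "h i = h k" for i k
  proof -
    have "bowen_dist X T n (fst (p i)) (fst (p k)) \<le> e / 2 + e / 2"
    proof (rule bowen_dist_triangle_le[OF nds(1) _ _ _ pos(2)])
      show "bowen_dist X T n (fst (p i)) (\<alpha> (fst (p i))) \<le> e / 2"
        using \<alpha>(2)[OF p(1)[OF that(1)]] by (simp add: bowen_dist_commute)
      show "bowen_dist X T n (\<alpha> (fst (p i))) (fst (p k)) \<le> e / 2"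
        using \<alpha>(2)[OF p(1)[OF that(2)]] that(3) by (simp add: h_def)
    qed (use p that sub(1) \<alpha>(1) E(2) in blast)+
    moreover have "bowen_dist Y R n (snd (p i)) (snd (p k)) \<le> e / 2 + e / 2"
    proof (rule bowen_dist_triangle_le[OF nds(2) _ _ _ pos(2)])
      show "bowen_dist Y R n (snd (p i)) (\<beta> (snd (p i))) \<le> e / 2"
        using \<beta>(2)[OF p(2)[OF that(1)]] by (simp add: bowen_dist_commute)
      show "bowen_dist Y R n (\<beta> (snd (p i))) (snd (p k)) \<le> e / 2"
        using \<beta>(2)[OF p(2)[OF that(2)]] that(3) by (simp add: h_def)
    qed (use p that sub(2) \<beta>(1) F(2) in blast)+
    moreover have "fst (p k) \<in> mspace (X 0)" "snd (p k) \<in> mspace (Y 0)"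
      using p[OF that(2)] sub by auto
    ultimately have "(fst (p k), snd (p k)) \<in>
        bowen_cball (prod_spaces X Y) (prod_maps T R) n (fst (p i), snd (p i)) e"
      unfolding bowen_cball_prod[OF pos(2)] mem_Times_iff by (simp add: bowen_cball_def)
    then show ?thesis by simp
  qed
  \<comment> \<open>If \<open>h i = h k\<close>, then \<open>p k\<close> lies in the balls around
    both \<open>p i\<close> and \<open>p k\<close>.\<close>
  have inj: "inj_on h J"
  proof (rule inj_onI, rule ccontr)
    fix i k assume ik: "i \<in> J" "k \<in> J" "h i = h k" "i \<noteq> k"
    with near[of i k] near[of k k] J(3) show False
      unfolding disjoint_family_on_def by blast
  qed
  have "(\<Sum>i\<in>J. weight (prod_maps T R) (dotplus f g) ((u + \<eta>) + (v + \<eta>)) n (p i))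
      \<le> (\<Sum>i\<in>J. weight T f u n (fst (h i)) * weight R g v n (snd (h i)))"
  proof (rule sum_mono)
    fix i assume i: "i \<in> J"
    have "weight (prod_maps T R) (dotplus f g) ((u + \<eta>) + (v + \<eta>)) n (p i) =
        weight T f (u + \<eta>) n (fst (p i)) * weight R g (v + \<eta>) n (snd (p i))"
      using weight_prod[of T R f g "u + \<eta>" "v + \<eta>" n "fst (p i)" "snd (p i)"] by simp
    also have "\<dots> \<le> weight T f u n (fst (h i)) * weight R g v n (snd (h i))"
    proof (rule mult_mono)
      show "weight T f (u + \<eta>) n (fst (p i)) \<le> weight T f u n (fst (h i))"
        unfolding h_def fst_conv
        by (rule weight_le[OF nds(1) _ _ pos(2) \<alpha>(2) f]) (use p[OF i] sub(1) \<alpha>(1) E(2) in auto)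
      show "weight R g (v + \<eta>) n (snd (p i)) \<le> weight R g v n (snd (h i))"
        unfolding h_def snd_conv
        by (rule weight_le[OF nds(2) _ _ pos(2) \<beta>(2) g]) (use p[OF i] sub(2) \<beta>(1) F(2) in auto)
    qed auto
    finally show "weight (prod_maps T R) (dotplus f g) ((u + \<eta>) + (v + \<eta>)) n (p i) \<le> \<dots>" .
  qed
  also have "\<dots> = (\<Sum>q\<in>h ` J. weight T f u n (fst q) * weight R g v n (snd q))"
    using inj by (simp add: sum.reindex)
  \<comment> \<open>Extending the sum from the image of \<open>h\<close> to the full rectangle adds
    nonnegative terms and lets it factorise.\<close>
  also have "\<dots> \<le> (\<Sum>q\<in>E \<times> F. weight T f u n (fst q) * weight R g v n (snd q))"
    using E(1) F(1) p \<alpha>(1) \<beta>(1) by (intro sum_mono2) (auto simp: h_def)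
  also have "\<dots> = (\<Sum>x\<in>E. weight T f u n x) * (\<Sum>y\<in>F. weight R g v n y)"
    by (simp add: sum_product sum.cartesian_product split_def)
  also have "\<dots> \<le> packing_pre X T f A u N (e / 4) * packing_pre Y R g B v N (e / 4)"
    using E F \<open>N \<le> n\<close> by (intro mult_mono sum_le_packing_pre) auto
  finally show ?thesis .
qed

text \<open>Half of \<delta> pays for summing over all orders by a geometric series, which makes the
  limit finite; the other half turns finite into zero.\<close>

lemma packing_lim_Times_eq_0:
  assumes nds: "nds X T" "nds Y R" and "0 < e" "0 < \<delta>"
    and sub: "A \<subseteq> mspace (X 0)" "B \<subseteq> mspace (Y 0)"
    and f: "\<And>k x y. x \<in> mspace (X k) \<Longrightarrow> y \<in> mspace (X k) \<Longrightarrow> mdist (X k) x y \<le> e / 2 \<Longrightarrow> \<bar>f k x - f k y\<bar> \<le> \<eta>"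
    and g: "\<And>k x y. x \<in> mspace (Y k) \<Longrightarrow> y \<in> mspace (Y k) \<Longrightarrow> mdist (Y k) x y \<le> e / 2 \<Longrightarrow> \<bar>g k x - g k y\<bar> \<le> \<eta>"
    and fin: "packing_lim X T f A u (e / 4) < \<infinity>" "packing_lim Y R g B v (e / 4) < \<infinity>"
  shows "packing_lim (prod_spaces X Y) (prod_maps T R) (dotplus f g) (A \<times> B) (u + v + 2 * \<eta> + \<delta>) e = 0"
proof -
  let ?P = "prod_spaces X Y" and ?Q = "prod_maps T R" and ?h = "dotplus f g"
  define s where "s = (u + \<eta>) + (v + \<eta>)"
  define q where "q = exp (- (\<delta> / 2))"
  have q: "0 < q" "q < 1"
    using \<open>0 < \<delta>\<close> by (auto simp: q_def)
  obtain N1 where N1: "packing_pre X T f A u N1 (e / 4) < \<infinity>"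
    using packing_lim_less_top_pre[OF fin(1)] .
  obtain N2 where N2: "packing_pre Y R g B v N2 (e / 4) < \<infinity>"
    using packing_lim_less_top_pre[OF fin(2)] .
  \<comment> \<open>The 1 keeps all orders positive, as \<open>sum_weight_prod_le\<close>
    requires.\<close>
  define N where "N = max 1 (max N1 N2)"
  define C where "C = packing_pre X T f A u N (e / 4) * packing_pre Y R g B v N (e / 4)"
  have "packing_pre X T f A u N (e / 4) < \<infinity>" "packing_pre Y R g B v N (e / 4) < \<infinity>"
    by (rule le_less_trans[OF packing_pre_antimono_N N1], simp add: N_def)
      (rule le_less_trans[OF packing_pre_antimono_N N2], simp add: N_def)
  then have C: "C < \<infinity>"
    by (simp add: C_def ennreal_mult_less_top)
  have "packing_pre ?P ?Q ?h (A \<times> B) (s + \<delta> / 2) N e \<le> ennreal (1 / (1 - q)) * C"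
  proof (rule packing_pre_leI)
    fix J :: "nat set" and n p
    assume J: "finite J" "\<And>i. i \<in> J \<Longrightarrow> N \<le> n i \<and> p i \<in> A \<times> B"
      "disjoint_family_on (\<lambda>i. bowen_cball ?P ?Q (n i) (p i) e) J"
    \<comment> \<open>The packing is split by order; the balls of order \<open>m\<close> contribute
      at most \<open>q ^ m\<close> times \<open>C\<close>.\<close>
    have "(\<Sum>i\<in>J. weight ?Q ?h (s + \<delta> / 2) (n i) (p i)) =
        (\<Sum>m\<in>n ` J. \<Sum>i\<in>{i\<in>J. n i = m}. weight ?Q ?h (s + \<delta> / 2) (n i) (p i))"
      by (rule sum.image_gen[OF J(1)])
    also have "\<dots> \<le> (\<Sum>m\<in>n ` J. ennreal (q ^ m) * C)"
    proof (rule sum_mono)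
      fix m assume "m \<in> n ` J"
      then have m: "N \<le> m" "0 < m"
        using J(2) by (force simp: N_def)+
      have q_power: "exp (- (real m * \<delta> / 2)) = q ^ m"
        by (simp add: q_def exp_of_nat_mult[symmetric])
      have "(\<Sum>i\<in>{i\<in>J. n i = m}. weight ?Q ?h (s + \<delta> / 2) (n i) (p i)) =
          ennreal (q ^ m) * (\<Sum>i\<in>{i\<in>J. n i = m}. weight ?Q ?h s m (p i))"
        unfolding sum_distrib_left
        by (intro sum.cong refl) (simp add: weight_add_exponent q_power)
      also have "(\<Sum>i\<in>{i\<in>J. n i = m}. weight ?Q ?h s m (p i)) \<le> C"
        unfolding s_def C_def
      proof (rule sum_weight_prod_le[OF nds \<open>0 < e\<close> m(2,1) sub f g])
        show "disjoint_family_on (\<lambda>i. bowen_cball ?P ?Q m (p i) e) {i \<in> J. n i = m}"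
          unfolding disjoint_family_on_def
        proof (intro ballI impI)
          fix i k assume "i \<in> {i \<in> J. n i = m}" "k \<in> {i \<in> J. n i = m}" "i \<noteq> k"
          with disjoint_family_onD[OF J(3), of i k]
          show "bowen_cball ?P ?Q m (p i) e \<inter> bowen_cball ?P ?Q m (p k) e = {}" by simp
        qed
      qed (use J in auto)
      finally show "(\<Sum>i\<in>{i\<in>J. n i = m}. weight ?Q ?h (s + \<delta> / 2) (n i) (p i)) \<le> ennreal (q ^ m) * C"
        by (simp add: mult_left_mono)
    qed
    also have "\<dots> = ennreal (\<Sum>m\<in>n ` J. q ^ m) * C"
      using q by (simp add: sum_distrib_right[symmetric] sum_ennreal)
    also have "(\<Sum>m\<in>n ` J. q ^ m) \<le> (\<Sum>m. q ^ m)"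
      using q J(1) by (intro sum_le_suminf summable_geometric) auto
    also have "(\<Sum>m. q ^ m) = 1 / (1 - q)"
      using q by (intro suminf_geometric) auto
    finally show "(\<Sum>i\<in>J. weight ?Q ?h (s + \<delta> / 2) (n i) (p i)) \<le> ennreal (1 / (1 - q)) * C"
      by (simp add: ennreal_leI mult_right_mono)
  qed
  moreover have "ennreal (1 / (1 - q)) * C < \<infinity>"
    using C by (simp add: ennreal_mult_less_top)
  moreover have "packing_lim ?P ?Q ?h (A \<times> B) (s + \<delta> / 2) e \<le> packing_pre ?P ?Q ?h (A \<times> B) (s + \<delta> / 2) N e"
    unfolding packing_lim_eq_INF by (rule INF_lower) simp
  ultimately have "packing_lim ?P ?Q ?h (A \<times> B) (s + \<delta> / 2) e < \<infinity>"
    by order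
  then show ?thesis
    by (rule packing_lim_eq_0_if_less) (use \<open>0 < \<delta>\<close> in \<open>simp add: s_def\<close>)
qed

lemma packing_pressure_at_prod_le:
  fixes X :: "nat \<Rightarrow> 'a metric" and Y :: "nat \<Rightarrow> 'b metric"
  assumes nds: "nds X T" "nds Y R" and "0 < e"
    and f: "\<And>k x y. x \<in> mspace (X k) \<Longrightarrow> y \<in> mspace (X k) \<Longrightarrow> mdist (X k) x y \<le> e / 2 \<Longrightarrow> \<bar>f k x - f k y\<bar> \<le> \<eta>"
    and g: "\<And>k x y. x \<in> mspace (Y k) \<Longrightarrow> y \<in> mspace (Y k) \<Longrightarrow> mdist (Y k) x y \<le> e / 2 \<Longrightarrow> \<bar>g k x - g k y\<bar> \<le> \<eta>"
    and u: "packing_pressure_at X T f Z (e / 4) < ereal u"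
    and v: "packing_pressure_at Y R g W (e / 4) < ereal v"
  shows "packing_pressure_at (prod_spaces X Y) (prod_maps T R) (dotplus f g) (Z \<times> W) e \<le> ereal (u + v + 2 * \<eta>)"
proof -
  obtain u' where u': "u' < u" "packing_meas X T f Z u' (e / 4) = 0"
    using u unfolding packing_pressure_at_def by (auto simp: Inf_less_iff)
  obtain v' where v': "v' < v" "packing_meas Y R g W v' (e / 4) = 0"
    using v unfolding packing_pressure_at_def by (auto simp: Inf_less_iff)
  obtain A :: "nat \<Rightarrow> 'a set" where A: "\<And>i. A i \<subseteq> mspace (X 0)" "Z \<subseteq> (\<Union>i. A i)" "\<And>i. packing_lim X T f (A i) u' (e / 4) < \<infinity>"
    by (rule packing_meas_eq_0E[OF u'(2)]) (rule that)
  obtain B :: "nat \<Rightarrow> 'b set" where B: "\<And>i. B i \<subseteq> mspace (Y 0)" "W \<subseteq> (\<Union>i. B i)" "\<And>i. packing_lim Y R g (B i) v' (e / 4) < \<infinity>"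
    by (rule packing_meas_eq_0E[OF v'(2)]) (rule that)
  \<comment> \<open>The slack between the chosen exponents and \<open>u\<close>, \<open>v\<close>
    supplies the positive \<delta> of \<open>packing_lim_Times_eq_0\<close>.\<close>
  define \<delta> where "\<delta> = (u - u') + (v - v')"
  have \<delta>: "0 < \<delta>" "u' + v' + 2 * \<eta> + \<delta> = u + v + 2 * \<eta>"
    using u'(1) v'(1) by (auto simp: \<delta>_def)
  have lim: "packing_lim (prod_spaces X Y) (prod_maps T R) (dotplus f g) (A i \<times> B j) (u + v + 2 * \<eta>) e = 0" for i j
    unfolding \<delta>(2)[symmetric]
    by (rule packing_lim_Times_eq_0[OF nds \<open>0 < e\<close> \<delta>(1) A(1) B(1) f g A(3) B(3)])
  have "packing_meas (prod_spaces X Y) (prod_maps T R) (dotplus f g) (Z \<times> W) (u + v + 2 * \<eta>) e = 0"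
  proof (rule packing_meas_eq_0I[of UNIV "\<lambda>(i, j). A i \<times> B j"])
    show "Z \<times> W \<subseteq> (\<Union>(i, j). A i \<times> B j)"
      using A(2) B(2) by fastforce
    show "(case ij of (i, j) \<Rightarrow> A i \<times> B j) \<subseteq> mspace (prod_spaces X Y 0)" for ij
      using A(1) B(1) by (cases ij) (auto simp: prod_spaces_def)
  qed (auto simp: lim)
  then show ?thesis
    unfolding packing_pressure_at_def by (intro Inf_lower) blast
qed

text \<open>Halving the modulus gives the non-strict form that fits closed balls.\<close>

lemma equicontinuous_cball:
  assumes "equicontinuous X f" "0 < \<eta>"
  obtains \<delta> where "0 < \<delta>"
    "\<And>k x y. x \<in> mspace (X k) \<Longrightarrow> y \<in> mspace (X k) \<Longrightarrow> mdist (X k) x y \<le> \<delta> \<Longrightarrow> \<bar>f k x - f k y\<bar> \<le> \<eta>"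
proof -
  from assms have "\<exists>\<delta>>0. \<forall>k. \<forall>x\<in>mspace (X k). \<forall>y\<in>mspace (X k).
      mdist (X k) x y < \<delta> \<longrightarrow> \<bar>f k x - f k y\<bar> < \<eta>"
    unfolding equicontinuous_def by simp
  then obtain \<delta> where \<delta>: "0 < \<delta>" "\<forall>k. \<forall>x\<in>mspace (X k). \<forall>y\<in>mspace (X k).
      mdist (X k) x y < \<delta> \<longrightarrow> \<bar>f k x - f k y\<bar> < \<eta>"
    by (elim exE conjE)
  show thesis
  proof (rule that[of "\<delta> / 2"])
    fix k x y assume "x \<in> mspace (X k)" "y \<in> mspace (X k)" "mdist (X k) x y \<le> \<delta> / 2"
    with \<delta> show "\<bar>f k x - f k y\<bar> \<le> \<eta>" by force
  qed (use \<delta>(1) in simp)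
qed

lemma packing_pressure_prod_le:
  assumes "nds X T" "nds Y R" "equicontinuous X f" "equicontinuous Y g"
  shows "packing_pressure (prod_spaces X Y) (prod_maps T R) (dotplus f g) (Z \<times> W)
    \<le> packing_pressure X T f Z + packing_pressure Y R g W"
    (is "?c \<le> ?a + ?b")
proof -
  let ?p = "packing_pressure_at (prod_spaces X Y) (prod_maps T R) (dotplus f g) (Z \<times> W)"
  have le: "?c \<le> ereal u + ereal v" if u: "?a < ereal u" and v: "?b < ereal v" for u v
  proof (rule ereal_le_epsilon2)
    fix d :: real assume "0 < d"
    \<comment> \<open>Each factor contributes an error of \<open>d / 2\<close>, in total
      \<open>d\<close>.\<close>
    then have \<eta>: "0 < d / 2" by simp
    obtain \<delta>1 where \<delta>1: "0 < \<delta>1"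
      "\<And>k x y. x \<in> mspace (X k) \<Longrightarrow> y \<in> mspace (X k) \<Longrightarrow> mdist (X k) x y \<le> \<delta>1 \<Longrightarrow> \<bar>f k x - f k y\<bar> \<le> d / 2"
      by (rule equicontinuous_cball[OF assms(3) \<eta>]) (rule that)
    obtain \<delta>2 where \<delta>2: "0 < \<delta>2"
      "\<And>k x y. x \<in> mspace (Y k) \<Longrightarrow> y \<in> mspace (Y k) \<Longrightarrow> mdist (Y k) x y \<le> \<delta>2 \<Longrightarrow> \<bar>g k x - g k y\<bar> \<le> d / 2"
      by (rule equicontinuous_cball[OF assms(4) \<eta>]) (rule that)
    define \<rho> where "\<rho> = min \<delta>1 \<delta>2"
    have "?p e \<le> ereal (u + v + d)" if e: "0 < e" for e
    proof -
      \<comment> \<open>Passing to a smaller radius only raises \<open>?p\<close> and brings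
        \<open>e' / 2\<close> within both moduli, so the bound holds for every
        \<open>e\<close>.\<close>
      define e' where "e' = min e \<rho>"
      have e': "0 < e'" "e' \<le> e" "e' / 2 \<le> \<delta>1" "e' / 2 \<le> \<delta>2"
        using e \<delta>1(1) \<delta>2(1) by (auto simp: e'_def \<rho>_def min_def)
      have "packing_pressure_at X T f Z (e' / 4) \<le> ?a"
        unfolding packing_pressure_eq_SUP using e'(1) by (intro SUP_upper) simp
      then have u': "packing_pressure_at X T f Z (e' / 4) < ereal u"
        using u by (rule le_less_trans)
      have "packing_pressure_at Y R g W (e' / 4) \<le> ?b"
        unfolding packing_pressure_eq_SUP using e'(1) by (intro SUP_upper) simp
      then have v': "packing_pressure_at Y R g W (e' / 4) < ereal v"
        using v by (rule le_less_trans)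
      have "?p e \<le> ?p e'"
        by (rule monotone_onD[OF packing_pressure_at_antimono]) (use e e' in auto)
      also have "\<dots> \<le> ereal (u + v + 2 * (d / 2))"
      proof (rule packing_pressure_at_prod_le[OF assms(1,2) e'(1) _ _ u' v'])
        show "\<bar>f k x - f k y\<bar> \<le> d / 2"
          if "x \<in> mspace (X k)" "y \<in> mspace (X k)" "mdist (X k) x y \<le> e' / 2" for k x y
          using \<delta>1(2)[OF that(1,2)] that(3) e'(3) by linarith
        show "\<bar>g k x - g k y\<bar> \<le> d / 2"
          if "x \<in> mspace (Y k)" "y \<in> mspace (Y k)" "mdist (Y k) x y \<le> e' / 2" for k x y
          using \<delta>2(2)[OF that(1,2)] that(3) e'(4) by linarith
      qed
      finally show ?thesis by simp
    qed
    then show "?c \<le> ereal u + ereal v + ereal d"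
      unfolding packing_pressure_eq_SUP by (intro SUP_least) simp
  qed
  show ?thesis
  \<comment> \<open>An infinite summand makes the sum \<infinity> in \<open>ereal\<close>, even
    against -\<infinity>, and the bound is trivial.\<close>
  proof (cases "?a = \<infinity> \<or> ?b = \<infinity>")
    case True
    then have "?a + ?b = \<infinity>" by auto
    then show ?thesis by (simp only: ereal_less_eq)
  next
    case False
    then show ?thesis
      by (intro ereal_le_add_if_greater[OF _ _ le]) simp_all
  qed
qed

theorem theorem6p2:
  fixes X :: "nat \<Rightarrow> 'a metric" and T :: "nat \<Rightarrow> 'a \<Rightarrow> 'a"
    and Y :: "nat \<Rightarrow> 'b metric" and R :: "nat \<Rightarrow> 'b \<Rightarrow> 'b"
    and f :: "nat \<Rightarrow> 'a \<Rightarrow> real" and g :: "nat \<Rightarrow> 'b \<Rightarrow> real"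
    and Z :: "'a set" and W :: "'b set"
  assumes "nds X T" and "nds Y R"
    and "Z \<subseteq> mspace (X 0)" and "W \<subseteq> mspace (Y 0)"
    and "f \<in> potentials X" and "equicontinuous X f"
    and "g \<in> potentials Y" and "equicontinuous Y g"
    and "sum_well_defined (bowen_pressure X T f Z) (packing_pressure Y R g W)"
    and "sum_well_defined (packing_pressure X T f Z) (packing_pressure Y R g W)"
  shows "bowen_pressure X T f Z + packing_pressure Y R g W
           \<le> packing_pressure (prod_spaces X Y) (prod_maps T R) (dotplus f g) (Z \<times> W)
       \<and> packing_pressure (prod_spaces X Y) (prod_maps T R) (dotplus f g) (Z \<times> W)
           \<le> packing_pressure X T f Z + packing_pressure Y R g W"
proof
  show "bowen_pressure X T f Z + packing_pressure Y R g W
      \<le> packing_pressure (prod_spaces X Y) (prod_maps T R) (dotplus f g) (Z \<times> W)"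
    by (rule bowen_pressure_add_packing_pressure_le) (rule assms)+
  show "packing_pressure (prod_spaces X Y) (prod_maps T R) (dotplus f g) (Z \<times> W)
      \<le> packing_pressure X T f Z + packing_pressure Y R g W"
    by (rule packing_pressure_prod_le) (rule assms)+
qed

end
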